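(* For every even integer $k\geq 0$ the function $g_k$ has the integral representation $$g_k(z)=\int_{-\Gamma(x_k)}^{-\Gamma(x_{k+1})}\frac{d_k(t)}{t-z}\,dt-k,\qquad z\in\mathbb C\setminus I_k,$$ where $I_k=[-\Gamma(x_k),-\Gamma(x_{k+1})]$ and $d_k(t)=\frac1\pi\,\Im g_k(t+i0)$.
   Context: $\mathbb C_+$ is the open upper half plane, $\Gamma$ is Euler's gamma function and $\gamma$ Euler's constant. For $k\ge 1$, $x_k$ denotes the unique zero of $\Gamma'$ in $(-k,-k+1)$, and $x_0$ denotes the unique zero of $\Gamma'$ in $(0,\infty)$. One has $\Gamma(x_k)<0$ for $k$ odd and $\Gamma(x_k)>0$ for $k$ even. The function $\log\Gamma(z)=-\gamma z-\log z-\sum_{j=1}^\infty\left(\log(1+z/j)-z/j\right)$ (principal logarithms) is holomorphic in $\mathbb C\setminus(-\infty,0]$, and it maps $\mathbb C_+$ conformally (bijectively) onto the domain $\mathcal V=\mathbb C\setminus\bigcup_{k=0}^\infty\{x-ik\pi : x\ge\log|\Gamma(x_k)|\}$. $(\log\Gamma)^{-1}:\mathcal V\to\mathbb C_+$ denotes the inverse of this conformal map. For $k\in\mathbb Z$ put $g_k(z)=(\log\Gamma)^{-1}(\log z-i(k+1)\pi)$ for $z\in\mathbb C_+$. For even $k\ge 0$, $I_k=[-\Gamma(x_k),-\Gamma(x_{k+1})]$; the function $g_k$ extends holomorphically to $\mathbb C\setminus I_k$ with $g_k(\overline z)=\overline{g_k(z)}$, and the extension is again denoted $g_k$. For $t\in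 I_k\setminus\{0\}$, $g_k(t+i0)=\lim_{y\to0+}g_k(t+iy)$. *)

theory Defs
  imports "HOL-Complex_Analysis.Complex_Analysis"
begin

definition Gamma_crit :: "nat \<Rightarrow> real" where
  "Gamma_crit k =
     (if k = 0 then THE x. 0 < x \<and> deriv Gamma x = 0
      else THE x. - real k < x \<and> x < - real k + 1 \<and> deriv Gamma x = 0)"

definition upper_half_plane :: "complex set" where
  "upper_half_plane = {z. 0 < Im z}"

text \<open>
  The holomorphic logarithm of Gamma on the complex plane slit along the nonpositive reals is
  the library function \<^const>\<open>ln_Gamma\<close>; the following lemma gives the defining series.
\<close>

lemma ln_Gamma_eq_series:
  assumes "z \<notin> \<real>\<^sub>\<le>\<^sub>0"
  shows "ln_Gamma z = - euler_mascheroni * z - Ln z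
           - (\<Sum>j. Ln (1 + z / of_nat (Suc j)) - z / of_nat (Suc j))"
proof -
  have "z \<notin> \<int>\<^sub>\<le>\<^sub>0"
    using assms nonpos_Ints_subset_nonpos_Reals by blast
  from sums_minus[OF ln_Gamma_series'_aux[OF this]]
  have "(\<lambda>j. Ln (1 + z / of_nat (Suc j)) - z / of_nat (Suc j))
          sums - (ln_Gamma z + euler_mascheroni * z + Ln z)"
    by simp
  then show ?thesis
    by (simp add: sums_iff)
qed

text \<open>
  The inverse of the conformal map \<^const>\<open>ln_Gamma\<close> from the upper half plane onto its image,
  the plane minus the half-lines \<open>{x - i k \<pi> : x \<ge> ln \<bar>\<Gamma>(x_k)\<bar>}\<close>, \<open>k \<ge> 0\<close>.
  Its values outside this image are irrelevant.
\<close>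

definition inv_ln_Gamma :: "complex \<Rightarrow> complex" where
  "inv_ln_Gamma = the_inv_into upper_half_plane ln_Gamma"

text \<open>Meaningful for \<open>z\<close> in the upper half plane only.\<close>

definition g_upper :: "int \<Rightarrow> complex \<Rightarrow> complex" where
  "g_upper k z = inv_ln_Gamma (Ln z - \<i> * (of_int k + 1) * of_real pi)"

text \<open>The interval is the intended one for even \<open>k\<close>, where \<open>\<Gamma>(x_k) > 0 > \<Gamma>(x_{k+1})\<close>.\<close>

definition I_cut :: "nat \<Rightarrow> real set" where
  "I_cut k = {- Gamma (Gamma_crit k) .. - Gamma (Gamma_crit (Suc k))}"

definition is_g_extension :: "nat \<Rightarrow> (complex \<Rightarrow> complex) \<Rightarrow> bool" where
  "is_g_extension k h \<longleftrightarrow>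
     h holomorphic_on (- complex_of_real ` I_cut k) \<and>
     (\<forall>z\<in>upper_half_plane. h z = g_upper (int k) z) \<and>
     (\<forall>z\<in>- complex_of_real ` I_cut k. h (cnj z) = cnj (h z))"

text \<open>
  The holomorphic extension of \<open>g_k\<close> to the complement of \<open>I_k\<close> (for even \<open>k\<close>). It is unique
  there by the lemma below; its values on \<open>I_k\<close> itself are arbitrary.
\<close>

definition g_ext :: "nat \<Rightarrow> complex \<Rightarrow> complex" where
  "g_ext k = (SOME h. is_g_extension k h)"

lemma is_g_extension_unique:
  assumes "is_g_extension k h1" "is_g_extension k h2"
    and "z \<in> - complex_of_real ` I_cut k"
  shows "h1 z = h2 z"
proof -
  let ?K = "complex_of_real ` I_cut k"
  have comp: "compact ?K"
    unfolding I_cut_def by (intro compact_continuous_image continuous_intros) auto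
  have conv: "convex ?K"
    unfolding I_cut_def
    by (intro convex_linear_image) (auto intro: bounded_linear.linear bounded_linear_of_real)
  show ?thesis
  proof (rule analytic_continuation_open[of upper_half_plane "- ?K" h1 h2])
    show "open upper_half_plane"
      unfolding upper_half_plane_def by (rule open_halfspace_Im_gt)
    show "open (- ?K)"
      using comp by (simp add: compact_imp_closed open_Compl)
    have "\<i> \<in> upper_half_plane" by (simp add: upper_half_plane_def)
    then show "upper_half_plane \<noteq> {}" by blast
    show "connected (- ?K)"
      using comp conv by (intro connected_complement_bounded_convex compact_imp_bounded) auto
    show "upper_half_plane \<subseteq> - ?K"
      by (auto simp: upper_half_plane_def)
  qed (use assms in \<open>auto simp: is_g_extension_def\<close>)
qed

text \<open>
  The boundary value \<open>g_k(t + i 0)\<close> is the limit from the upper half plane. At \<open>t = 0\<close> the limit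
  does not exist and the value of \<open>d_k\<close> is arbitrary, which does not affect the integral.
\<close>

definition d_density :: "nat \<Rightarrow> real \<Rightarrow> real" where
  "d_density k t =
     Im (Lim (at_right 0) (\<lambda>y::real. g_ext k (complex_of_real t + \<i> * complex_of_real y))) / pi"

end

theory Submission
  imports Defs
begin

text \<open>
  The imaginary part of the digamma function is positive in the upper half plane, so \<^const>\<open>ln_Gamma\<close>
  is injective there. Points at which \<^const>\<open>ln_Gamma\<close> is bounded with negative imaginary part stay
  bounded, and at the real line the imaginary part tends to a multiple of \<open>\<pi>\<close>; so the image
  meets each strip \<open>-(k + 1) \<pi> < Im w < -k \<pi>\<close> in a closed and open nonempty set, that is, contains it.
  By construction \<open>\<Gamma> (g\<^sub>k z) = -z\<close>. Hence near real points off \<open>I\<^sub>k\<close>, and near infinity, \<open>g\<^sub>k z\<close> is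
  the local inverse of the entire function \<open>1 / \<Gamma>\<close> at \<open>-1 / z\<close>, based at a real point between
  \<open>x\<^bsub>k+1\<^esub>\<close> and \<open>x\<^sub>k\<close> where \<open>1 / \<Gamma>\<close> is increasing; infinity corresponds to the pole \<open>-k\<close>. This gives
  the extension by reflection and \<open>g\<^sub>k \<rightarrow> -k\<close> at infinity. The decay of \<open>\<Gamma>\<close> in the
  imaginary direction gives \<open>0 < Im g\<^sub>k z \<le> 1 + C \<bar>z\<bar> powr (-1/2)\<close>, an integrable majorant with which
  Cauchy's formula on the line \<open>Im = \<epsilon>\<close> passes to the limit \<open>\<epsilon> \<rightarrow> 0\<close>.
\<close>

section \<open>The logarithm of Gamma in the upper half plane\<close>

lemma Im_pos_notin_nonpos_Reals: "Im z > 0 \<Longrightarrow> z \<notin> \<real>\<^sub>\<le>\<^sub>0"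
  by (simp add: complex_nonpos_Reals_iff)

lemma Im_pos_notin_nonpos_Ints: "Im z > 0 \<Longrightarrow> z \<notin> \<int>\<^sub>\<le>\<^sub>0"
  using Im_pos_notin_nonpos_Reals nonpos_Ints_subset_nonpos_Reals by blast

lemma open_upper_half_plane: "open upper_half_plane"
  unfolding upper_half_plane_def by (rule open_halfspace_Im_gt)

lemma convex_upper_half_plane: "convex upper_half_plane"
  unfolding upper_half_plane_def by (rule convex_halfspace_Im_gt)

lemma ln_Gamma_holomorphic_upper: "ln_Gamma holomorphic_on upper_half_plane"
  by (intro holomorphic_ln_Gamma) (use Im_pos_notin_nonpos_Reals in \<open>auto simp: upper_half_plane_def\<close>)

text \<open>Each term -1/(z + n) of the series for \<open>Digamma\<close> has positive imaginary
  part. This is what makes \<open>ln_Gamma\<close> injective on the half plane.\<close>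

lemma Im_Digamma_pos:
  assumes "Im z > 0"
  shows "Im (Digamma z) > 0"
proof -
  have z0: "z \<noteq> 0" using assms by auto
  have lim: "(\<lambda>m. Im (of_real (ln (real m)) - (\<Sum>n<m. inverse (z + of_nat n)))) \<longlonglongrightarrow> Im (Digamma z)"
    by (intro tendsto_Im Digamma_LIMSEQ z0)
  have term_pos: "- Im (inverse (z + of_nat n)) > 0" for n
    using assms by (simp add: divide_neg_pos sum_power2_gt_zero_iff)
  \<comment> \<open>The single term n = 0 is a lower bound independent of m, so strictness survives
    the limit.\<close>
  have "- Im (inverse z) \<le> Im (Digamma z)"
  proof (rule tendsto_lowerbound[OF lim])
    show "\<forall>\<^sub>F m in sequentially. - Im (inverse z) \<le>
        Im (of_real (ln (real m)) - (\<Sum>n<m. inverse (z + of_nat n)))"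
    proof (rule eventually_sequentiallyI[of 1])
      fix m :: nat assume "m \<ge> 1"
      have "- Im (inverse z) = (\<Sum>n\<in>{0}. - Im (inverse (z + of_nat n)))" by simp
      also have "\<dots> \<le> (\<Sum>n<m. - Im (inverse (z + of_nat n)))"
        using \<open>m \<ge> 1\<close> term_pos by (intro sum_mono2) (auto intro: less_imp_le)
      finally show "- Im (inverse z) \<le>
        Im (of_real (ln (real m)) - (\<Sum>n<m. inverse (z + of_nat n)))"
        by (simp only: minus_complex.sel Im_sum Im_complex_of_real sum_negf)
    qed
  qed auto
  with term_pos[of 0] show ?thesis by simp
qed

text \<open>Termwise Re 1/(x + iy) <= 1/x for x > 0. This carries the sign of the real digamma
  function to vertical lines.\<close>

lemma Re_Digamma_ge:
  assumes "Re z > 0"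
  shows "Digamma (Re z) \<le> Re (Digamma z)"
proof -
  have z0: "z \<noteq> 0" "Re z \<noteq> 0" using assms by auto
  have lim: "(\<lambda>m. Re (of_real (ln (real m)) - (\<Sum>n<m. inverse (z + of_nat n)))) \<longlonglongrightarrow> Re (Digamma z)"
    by (intro tendsto_Re Digamma_LIMSEQ z0)
  have lim': "(\<lambda>m. of_real (ln (real m)) - (\<Sum>n<m. inverse (Re z + of_nat n))) \<longlonglongrightarrow> Digamma (Re z)"
    by (intro Digamma_LIMSEQ z0)
  have le: "Re (inverse (z + of_nat n)) \<le> inverse (Re z + of_nat n)" for n
  proof -
    define x where "x = Re z + real n"
    have x: "x > 0" using assms by (simp add: x_def add_pos_nonneg)
    have "x / (x\<^sup>2 + (Im z)\<^sup>2) \<le> x / x\<^sup>2"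
      using x by (intro divide_left_mono) (auto simp: sum_power2_gt_zero_iff)
    also have "\<dots> = inverse x" using x by (simp add: power2_eq_square field_simps)
    finally show ?thesis by (simp add: x_def)
  qed
  show ?thesis
  proof (rule LIMSEQ_le[OF lim' lim], intro exI allI impI)
    fix m :: nat
    have "(\<Sum>n<m. Re (inverse (z + of_nat n))) \<le> (\<Sum>n<m. inverse (Re z + of_nat n))"
      by (intro sum_mono le)
    then show "of_real (ln (real m)) - (\<Sum>n<m. inverse (Re z + of_nat n))
      \<le> Re (of_real (ln (real m)) - (\<Sum>n<m. inverse (z + of_nat n)))"
      by (simp only: minus_complex.sel Re_sum Re_complex_of_real) simp
  qed
qed

text \<open>Noshiro--Warschawski: the difference quotient along a segment averages the derivative.\<close>

lemma inj_on_convex_linear_deriv_pos: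
  fixes f :: "complex \<Rightarrow> complex" and c :: complex
  assumes "convex S"
    and "\<And>z. z \<in> S \<Longrightarrow> (f has_field_derivative f' z) (at z)"
    and "\<And>z. z \<in> S \<Longrightarrow> Re (c * f' z) > 0"
  shows "inj_on f S"
proof (rule inj_onI, rule ccontr)
  fix a b assume ab: "a \<in> S" "b \<in> S" "f a = f b" "a \<noteq> b"
  define \<gamma> where "\<gamma> t = a + of_real t * (b - a)" for t :: real
  define u where "u t = Re (c * (f (\<gamma> t) / (b - a)))" for t :: real
  have in_S: "\<gamma> t \<in> S" if "0 \<le> t" "t \<le> 1" for t
  proof -
    have "\<gamma> t = (1 - t) *\<^sub>R a + t *\<^sub>R b"
      by (simp add: \<gamma>_def scaleR_conv_of_real algebra_simps)
    then show ?thesis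
      using assms(1) ab that by (simp add: convexD_alt)
  qed
  have du: "(u has_real_derivative Re (c * f' (\<gamma> t))) (at t)" if "0 \<le> t" "t \<le> 1" for t
  proof -
    have "(\<gamma> has_vector_derivative (b - a)) (at t)"
      unfolding \<gamma>_def by (auto intro!: derivative_eq_intros)
    from field_vector_diff_chain_at[OF this assms(2)[OF in_S[OF that]]]
    have "((\<lambda>t. f (\<gamma> t)) has_vector_derivative (b - a) * f' (\<gamma> t)) (at t)"
      by (simp add: o_def)
    then have "((\<lambda>t. c / (b - a) * f (\<gamma> t)) has_vector_derivative c / (b - a) * ((b - a) * f' (\<gamma> t))) (at t)"
      by (rule has_vector_derivative_mult_right)
    then have "((\<lambda>t. c * (f (\<gamma> t) / (b - a))) has_vector_derivative c * f' (\<gamma> t)) (at t)"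
      using \<open>a \<noteq> b\<close> by (simp add: mult.assoc[symmetric])
    then show ?thesis
      unfolding u_def has_real_derivative_iff_has_vector_derivative
      by (rule bounded_linear.has_vector_derivative[OF bounded_linear_Re])
  qed
  have "u 0 < u 1"
    by (rule DERIV_pos_imp_increasing[of 0 1]) (use du assms(3) in_S in fastforce)+
  then show False using ab by (simp add: u_def \<gamma>_def)
qed

lemma inj_on_ln_Gamma: "inj_on ln_Gamma upper_half_plane"
  by (rule inj_on_convex_linear_deriv_pos[where f' = Digamma and c = "-\<i>"])
    (use convex_upper_half_plane in \<open>auto simp: upper_half_plane_def Im_Digamma_pos
      intro!: has_field_derivative_ln_Gamma_complex Im_pos_notin_nonpos_Reals\<close>)

text \<open>The functional equation of Gamma gives this only modulo 2 pi i. The difference of the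
  two sides has derivative zero on the connected slit plane and vanishes at 1.\<close>

lemma ln_Gamma_complex_plus1:
  assumes "Im z > 0"
  shows "ln_Gamma (z + 1) = ln_Gamma z + Ln z"
proof -
  define D where "D z = ln_Gamma (z + 1) - ln_Gamma z - Ln z" for z
  define S :: "complex set" where "S = - \<real>\<^sub>\<le>\<^sub>0"
  have "\<real>\<^sub>\<le>\<^sub>0 = complex_of_real ` {..0}" by (auto elim: nonpos_Reals_cases)
  then have star: "starlike S" unfolding S_def using starlike_slotted_complex_plane_left by metis
  have op: "open S" by (simp add: S_def open_Compl)
  have der: "(D has_field_derivative 0) (at z)" if "z \<in> S" for z
  proof -
    have "z + 1 \<notin> \<real>\<^sub>\<le>\<^sub>0" "z \<noteq> 0" "z \<notin> \<real>\<^sub>\<le>\<^sub>0"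
      using that by (auto simp: S_def complex_nonpos_Reals_iff)
    then show ?thesis unfolding D_def
      by (auto intro!: derivative_eq_intros simp: Digamma_plus1 divide_inverse)
  qed
  have "\<exists>c. \<forall>x\<in>S. D x = c"
    by (rule DERIV_zero_connected_constant[of S "{}"])
      (use der op star starlike_imp_connected in \<open>auto intro!: DERIV_continuous_on
        intro: has_field_derivative_at_within\<close>)
  then obtain c where c: "\<And>x. x \<in> S \<Longrightarrow> D x = c" by auto
  have "z \<in> S" "(1::complex) \<in> S"
    using Im_pos_notin_nonpos_Reals[OF assms] by (auto simp: S_def)
  then have "D z = D 1" using c by metis
  also have "D 1 = 0"
    using ln_Gamma_complex_conv_fact[of 1] ln_Gamma_complex_conv_fact[of 2] by (simp add: D_def)
  finally show ?thesis by (simp add: D_def algebra_simps)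
qed

lemma ln_Gamma_complex_plus_of_nat:
  assumes "Im z > 0"
  shows "ln_Gamma (z + of_nat n) = ln_Gamma z + (\<Sum>i<n. Ln (z + of_nat i))"
proof (induction n)
  case (Suc n)
  have "ln_Gamma (z + of_nat n + 1) = ln_Gamma (z + of_nat n) + Ln (z + of_nat n)"
    using assms by (intro ln_Gamma_complex_plus1) simp
  with Suc show ?case by (simp add: add_ac)
qed simp

text \<open>Moves a point to the right, where the logarithm is under control, at the price of a sum
  of arguments in (0, pi).\<close>

lemma Im_ln_Gamma_shift:
  assumes "Im z > 0"
  shows "Im (ln_Gamma z) = Im (ln_Gamma (z + of_nat n)) - (\<Sum>i<n. Im (Ln (z + of_nat i)))"
  using ln_Gamma_complex_plus_of_nat[OF assms, of n] by simp

lemma Im_Ln_minus: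
  assumes "Im z > 0"
  shows "Im (Ln z) = Im (Ln (- z)) + pi"
proof -
  have "z \<noteq> 0" using assms by auto
  with Ln_minus[of z] assms show ?thesis by auto
qed

text \<open>On the vertical line above x = Re z the imaginary part starts at 0 and has derivative Re
  \<open>Digamma\<close> >= \<open>Digamma\<close> x > 0, since 2 lies beyond the positive zero of
  \<open>Digamma\<close>.\<close>

lemma Im_ln_Gamma_nonneg:
  assumes "Re z \<ge> 2" "Im z > 0"
  shows "Im (ln_Gamma z) \<ge> 0"
proof -
  define x where "x = Re z"
  have dig: "Digamma x > 0"
    using Digamma_real_ge_three_halves_pos[of x] assms by (simp add: x_def)
  define u where "u y = Im (ln_Gamma (Complex x y))" for y
  have "u 0 \<le> u (Im z)"
  proof (rule DERIV_nonneg_imp_nondecreasing[of 0 _ u])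
    fix t :: real assume "0 \<le> t"
    have nr: "Complex x t \<notin> \<real>\<^sub>\<le>\<^sub>0" using assms by (auto simp: complex_nonpos_Reals_iff x_def)
    have "((\<lambda>t. of_real x + of_real t * \<i>) has_vector_derivative \<i>) (at t)"
      by (auto intro!: derivative_eq_intros)
    then have "(Complex x has_vector_derivative \<i>) (at t)"
      by (simp add: Complex_eq[abs_def] mult.commute)
    then have "((\<lambda>t. ln_Gamma (Complex x t)) has_vector_derivative \<i> * Digamma (Complex x t)) (at t)"
      using field_vector_diff_chain_at has_field_derivative_ln_Gamma_complex[OF nr] by (fastforce simp: o_def)
    then have "(u has_real_derivative Im (\<i> * Digamma (Complex x t))) (at t)"
      unfolding u_def has_real_derivative_iff_has_vector_derivative by (rule bounded_linear.has_vector_derivative[OF bounded_linear_Im])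
    moreover have "Re (Digamma (Complex x t)) \<ge> 0"
      using Re_Digamma_ge[of "Complex x t"] dig assms by (simp add: x_def)
    ultimately show "\<exists>d. (u has_real_derivative d) (at t) \<and> d \<ge> 0" by auto
  qed (use assms in auto)
  moreover have "u 0 = 0"
    using ln_Gamma_complex_of_real[of x] assms by (simp add: u_def x_def complex_of_real_def)
  moreover have "u (Im z) = Im (ln_Gamma z)" by (simp add: u_def x_def)
  ultimately show ?thesis by simp
qed

section \<open>Size and boundary behaviour of Gamma and its logarithm\<close>

lemma norm_Gamma_le:
  fixes z :: complex
  assumes "Re z > 0"
  shows "norm (Gamma z) \<le> Gamma (Re z)"
proof (rule LIMSEQ_le[OF tendsto_norm[OF Gamma_series_LIMSEQ] Gamma_series_LIMSEQ])
  have "norm (Gamma_series z n) \<le> Gamma_series (Re z) n" if "n \<ge> 1" for n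
  proof -
    \<comment> \<open>Factor by factor |z + i| >= Re z + i, while the modulus of exp (z ln n)
      depends on Re z only.\<close>
    have "pochhammer (Re z) (n+1) \<le> norm (pochhammer z (n+1))"
      unfolding pochhammer_prod prod_norm[symmetric]
    proof (rule prod_mono)
      fix i assume "i \<in> {0..<n+1}"
      show "0 \<le> Re z + of_nat i \<and> Re z + of_nat i \<le> norm (z + of_nat i)"
        using complex_Re_le_cmod[of "z + of_nat i"] assms by simp
    qed
    moreover have "pochhammer (Re z) (n+1) > 0" using assms by (rule pochhammer_pos)
    ultimately have "fact n * exp (Re z * ln n) / norm (pochhammer z (n+1))
        \<le> fact n * exp (Re z * ln n) / pochhammer (Re z) (n+1)"
      by (intro divide_left_mono mult_pos_pos) auto
    then show ?thesis
      by (simp add: Gamma_series_def norm_mult norm_divide mult_ac)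
  qed
  then show "\<exists>N. \<forall>n\<ge>N. norm (Gamma_series z n) \<le> Gamma_series (Re z) n" by blast
qed

text \<open>Gamma p equals Gamma at a shifted point of the strip 4 <= Re <= 5 divided by at least
  two factors of modulus >= Im p. The exponent 2 later becomes the integrable singularity
  |z|^(-1/2).\<close>

lemma norm_Gamma_decay:
  "\<exists>C>0. \<forall>p::complex. Re p \<le> 2 \<longrightarrow> 1 \<le> Im p \<longrightarrow> (Im p)\<^sup>2 * norm (Gamma p) \<le> C"
proof (intro exI[of _ "Gamma 5"] conjI allI impI)
  fix p :: complex assume p: "Re p \<le> 2" "1 \<le> Im p"
  define q where "q = Im p"
  \<comment> \<open>Since Re p <= 2, reaching real part 4 takes at least two shifts; on [4, 5] Gamma
    is increasing, whence the constant \<open>Gamma 5\<close>.\<close>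
  define n where "n = nat \<lceil>4 - Re p\<rceil>"
  have n: "2 \<le> n" "4 \<le> Re p + n" "Re p + n \<le> 5"
    using p unfolding n_def by linarith+
  have "pochhammer p n = Gamma (p + of_nat n) / Gamma p"
    using p by (intro pochhammer_Gamma Im_pos_notin_nonpos_Ints) simp
  moreover have "Gamma p \<noteq> 0"
    using p by (simp add: Gamma_eq_zero_iff Im_pos_notin_nonpos_Ints)
  ultimately have eq: "norm (pochhammer p n) * norm (Gamma p) = norm (Gamma (p + of_nat n))"
    by (simp add: norm_divide)
  have "q\<^sup>2 \<le> q ^ n" using p n by (intro power_increasing) (auto simp: q_def)
  also have "\<dots> = (\<Prod>i\<in>{0..<n}. q)" by simp
  also have "\<dots> \<le> (\<Prod>i\<in>{0..<n}. norm (p + of_nat i))"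
  proof (rule prod_mono)
    fix i
    show "0 \<le> q \<and> q \<le> norm (p + of_nat i)"
      using abs_Im_le_cmod[of "p + of_nat i"] p by (simp add: q_def)
  qed
  also have "\<dots> = norm (pochhammer p n)" by (simp add: pochhammer_prod prod_norm)
  finally have "q\<^sup>2 * norm (Gamma p) \<le> norm (Gamma (p + of_nat n))"
    using mult_right_mono[OF _ norm_ge_zero] eq by metis
  also have "\<dots> \<le> Gamma (Re p + n)"
    using norm_Gamma_le[of "p + of_nat n"] n by simp
  also have "\<dots> \<le> Gamma 5"
    using Gamma_real_strict_mono[of "Re p + n" 5] n by (cases "Re p + n = 5") (auto intro: less_imp_le)
  finally show "(Im p)\<^sup>2 * norm (Gamma p) \<le> Gamma 5" by (simp add: q_def)
qed auto

text \<open>Every shift factor with nonpositive real part has argument at least pi/2, so the bound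
  falls linearly as p moves left. It confines preimages on the left and also produces very negative
  imaginary parts.\<close>

lemma Im_ln_Gamma_upper_bound:
  "\<exists>V. \<forall>p. 0 < Im p \<longrightarrow> Im p \<le> Y \<longrightarrow> Re p \<le> 1 \<longrightarrow> Im (ln_Gamma p) \<le> V + Re p * pi / 2"
proof -
  \<comment> \<open>The closed rectangle includes its base on the real axis, so the bound is uniform
    as Im p tends to 0.\<close>
  define K where "K = cbox (Complex 1 0) (Complex 2 Y)"
  have "compact (ln_Gamma ` K)"
    unfolding K_def
    by (intro compact_continuous_image continuous_on_ln_Gamma_complex compact_cbox)
      (auto simp: in_cbox_complex_iff complex_nonpos_Reals_iff)
  then obtain V where V: "\<And>p. p \<in> K \<Longrightarrow> norm (ln_Gamma p) \<le> V"
    using compact_imp_bounded bounded_iff by (metis imageI)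
  show ?thesis
  proof (intro exI[of _ V] allI impI)
    fix p assume p: "0 < Im p" "Im p \<le> Y" "Re p \<le> 1"
    define n where "n = nat \<lceil>1 - Re p\<rceil>"
    have n: "1 \<le> Re p + n" "Re p + n \<le> 2" "real n \<ge> 1 - Re p" "n \<ge> 1 \<Longrightarrow> Re p + (real n - 1) < 1"
      using p unfolding n_def by linarith+
    have "p + of_nat n \<in> K" using p n by (auto simp: K_def in_cbox_complex_iff)
    then have 1: "Im (ln_Gamma (p + of_nat n)) \<le> V"
      using V abs_Im_le_cmod order_trans by (metis abs_le_iff)
    \<comment> \<open>The last of the n factors may have positive real part and counts only as
      nonnegative; the others give pi/2 each.\<close>
    have "(real n - 1) * (pi / 2) \<le> (\<Sum>i<n. Im (Ln (p + of_nat i)))"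
    proof (cases n)
      case (Suc m)
      have "real m * (pi / 2) = (\<Sum>i<m. pi / 2)" by simp
      also have "\<dots> \<le> (\<Sum>i<m. Im (Ln (p + of_nat i)))"
      proof (rule sum_mono)
        fix i assume "i \<in> {..<m}"
        then have i: "i + 1 \<le> m" by simp
        then have "real i + 1 \<le> real m" by linarith
        then have "Re (p + of_nat i) \<le> 0" using n(4) Suc by simp
        then have "\<not> \<bar>Im (Ln (p + of_nat i))\<bar> < pi / 2"
          using p(1) by (subst Re_Ln_pos_lt) (auto simp: complex_eq_iff)
        moreover have "0 < Im (Ln (p + of_nat i))"
          using Im_Ln_pos_lt_imp[of "p + of_nat i"] p(1) by simp
        ultimately show "pi / 2 \<le> Im (Ln (p + of_nat i))" by simp
      qed
      also have "\<dots> \<le> (\<Sum>i<n. Im (Ln (p + of_nat i)))"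
        using Im_Ln_pos_lt_imp[of "p + of_nat m"] p(1) Suc by simp
      finally show ?thesis using Suc by simp
    qed (simp)
    moreover have "- Re p * (pi / 2) \<le> (real n - 1) * (pi / 2)"
      using n(3) by (intro mult_right_mono) auto
    ultimately show "Im (ln_Gamma p) \<le> V + Re p * pi / 2"
      using Im_ln_Gamma_shift[OF p(1), of n] 1 by simp
  qed
qed

text \<open>The sum of arguments jumps by \<open>\<pi>\<close> for each pole passed to the left; replacing
  \<open>Ln \<zeta>\<close> by \<open>Ln (- \<zeta>) + i \<pi>\<close> for those terms makes the continuity at the boundary visible.\<close>

lemma tendsto_Im_ln_Gamma_boundary:
  fixes x :: real
  assumes "x + real m > 0" "\<And>i. i < j \<Longrightarrow> x + real i < 0"
  shows "((\<lambda>\<zeta>. Im (ln_Gamma (\<zeta> + of_nat m)) - (\<Sum>i<j. Im (Ln (- (\<zeta> + of_nat i))))) \<longlongrightarrow> 0)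
    (at (complex_of_real x))"
proof -
  let ?f = "\<lambda>\<zeta>. Im (ln_Gamma (\<zeta> + of_nat m)) - (\<Sum>i<j. Im (Ln (- (\<zeta> + of_nat i))))"
  have "isCont ?f (complex_of_real x)"
    by (intro continuous_intros isCont_Im isCont_Ln' isCont_ln_Gamma_complex)
      (use assms in \<open>fastforce simp: complex_nonpos_Reals_iff\<close>)+
  moreover have "?f (complex_of_real x) = 0"
  proof -
    have "Im (ln_Gamma (complex_of_real (x + real m))) = 0"
      using assms(1) by (subst ln_Gamma_complex_of_real) auto
    moreover have "Im (Ln (- (complex_of_real x + of_nat i))) = 0" if "i < j" for i
    proof -
      have "Ln (of_real (- (x + real i))) = of_real (ln (- (x + real i)))"
        using assms(2)[OF that] by (intro Ln_of_real) auto
      then show ?thesis by (metis Im_complex_of_real of_real_add of_real_minus of_real_of_nat_eq)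
    qed
    ultimately show ?thesis by simp
  qed
  ultimately show ?thesis by (simp add: isCont_def)
qed

text \<open>From above, each of the j negative factors x + i with i < j contributes an argument pi.
  So boundary values on the j-th interval lie on the line of the j-th slit.\<close>

lemma tendsto_Im_ln_Gamma_real:
  fixes x :: real
  assumes "x + real j > 0" "j > 0 \<Longrightarrow> x + real j < 1"
  shows "((\<lambda>\<zeta>. Im (ln_Gamma \<zeta>)) \<longlongrightarrow> - real j * pi) (at (complex_of_real x) within upper_half_plane)"
proof -
  have "x + real i < 0" if "i < j" for i
  proof -
    have "real i + 1 \<le> real j" using that by linarith
    then show ?thesis using assms(2) that by simp
  qed
  from tendsto_Im_ln_Gamma_boundary[OF assms(1) this]
  have "((\<lambda>\<zeta>. Im (ln_Gamma (\<zeta> + of_nat j)) - (\<Sum>i<j. Im (Ln (- (\<zeta> + of_nat i)))) - real j * pi)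
     \<longlongrightarrow> 0 - real j * pi) (at (complex_of_real x) within upper_half_plane)"
    by (intro tendsto_intros) (auto intro: tendsto_within_subset)
  moreover have "Im (ln_Gamma (\<zeta> + of_nat j)) - (\<Sum>i<j. Im (Ln (- (\<zeta> + of_nat i)))) - real j * pi
      = Im (ln_Gamma \<zeta>)" if "\<zeta> \<in> upper_half_plane" for \<zeta>
  proof -
    have \<zeta>: "Im \<zeta> > 0" using that by (simp add: upper_half_plane_def)
    have "Im (Ln (\<zeta> + of_nat i)) = Im (Ln (- (\<zeta> + of_nat i))) + pi" for i
      using \<zeta> by (intro Im_Ln_minus) simp
    then show ?thesis using Im_ln_Gamma_shift[OF \<zeta>, of j] by (simp add: sum.distrib)
  qed
  ultimately show ?thesis
    by (subst (asm) Lim_cong_within[OF refl refl refl]) auto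
qed

text \<open>Here x may be the pole -k itself, so the argument of the factor at index k is only known
  to lie in (0, pi); the other terms are within pi of their limit. The window is just narrow enough
  to identify a branch modulo 2 pi i later.\<close>

lemma eventually_Im_ln_Gamma_near_pole:
  fixes x :: real
  assumes "x + real k + 1 > 0" "k > 0 \<Longrightarrow> x + real k < 1"
  shows "\<forall>\<^sub>F \<zeta> in at (complex_of_real x). Im \<zeta> > 0 \<longrightarrow>
     - (real k + 2) * pi < Im (ln_Gamma \<zeta>) \<and> Im (ln_Gamma \<zeta>) < (1 - real k) * pi"
proof -
  have "x + real i < 0" if "i < k" for i
  proof -
    have "real i + 1 \<le> real k" using that by linarith
    then show ?thesis using assms(2) that by simp
  qed
  moreover have "x + real (Suc k) > 0" using assms(1) by simp
  ultimately have "((\<lambda>\<zeta>. Im (ln_Gamma (\<zeta> + of_nat (Suc k))) - (\<Sum>i<k. Im (Ln (- (\<zeta> + of_nat i))))) \<longlongrightarrow> 0)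
    (at (complex_of_real x))"
    by (rule tendsto_Im_ln_Gamma_boundary[rotated])
  from tendstoD[OF this pi_gt_zero]
  show ?thesis
  proof eventually_elim
    case (elim \<zeta>)
    show ?case
    proof
      assume \<zeta>: "Im \<zeta> > 0"
      have "Im (Ln (\<zeta> + of_nat i)) = Im (Ln (- (\<zeta> + of_nat i))) + pi" for i
        using \<zeta> by (intro Im_Ln_minus) simp
      then have "Im (ln_Gamma \<zeta>) = Im (ln_Gamma (\<zeta> + of_nat (Suc k))) - (\<Sum>i<k. Im (Ln (- (\<zeta> + of_nat i))))
           - real k * pi - Im (Ln (\<zeta> + of_nat k))"
        using Im_ln_Gamma_shift[OF \<zeta>, of "Suc k"] by (simp add: sum.distrib algebra_simps)
      moreover have "0 < Im (Ln (\<zeta> + of_nat k)) \<and> Im (Ln (\<zeta> + of_nat k)) < pi"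
        using \<zeta> by (intro Im_Ln_pos_lt_imp) simp
      ultimately show "- (real k + 2) * pi < Im (ln_Gamma \<zeta>) \<and> Im (ln_Gamma \<zeta>) < (1 - real k) * pi"
        using elim by (simp add: dist_real_def algebra_simps abs_less_iff)
    qed
  qed
qed

section \<open>Critical points of Gamma and the image of the logarithm\<close>

text \<open>The components of the real line without the poles of Gamma, numbered so that x_j lies in
  component j; this unites the two cases of \<open>Gamma_crit\<close>.\<close>

definition Gamma_branch :: "nat \<Rightarrow> real set" where
  "Gamma_branch j = {x. 0 < x + real j \<and> (j > 0 \<longrightarrow> x + real j < 1)}"

lemma Gamma_branch_notin_nonpos_Ints:
  assumes "x \<in> Gamma_branch j"
  shows "x \<notin> \<int>\<^sub>\<le>\<^sub>0"
proof
  assume "x \<in> \<int>\<^sub>\<le>\<^sub>0"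
  then obtain n where n: "x = - real n" by (auto elim: nonpos_Ints_cases')
  show False
  proof (cases "j > 0")
    case True
    then have "real n < real j" "real j < real (n + 1)" using assms n by (auto simp: Gamma_branch_def)
    then show False by (simp only: of_nat_less_iff)
  qed (use assms n in \<open>auto simp: Gamma_branch_def\<close>)
qed

lemma Gamma_branch_exhaust:
  fixes x :: real
  assumes "x \<notin> \<int>\<^sub>\<le>\<^sub>0"
  obtains j where "x \<in> Gamma_branch j"
proof (cases "x > 0")
  case True
  then have "x \<in> Gamma_branch 0" by (simp add: Gamma_branch_def)
  then show ?thesis by (rule that)
next
  case False
  define j where "j = nat \<lceil>- x\<rceil>"
  have j: "- x \<le> real j" "real j < - x + 1" using False unfolding j_def by linarith+
  have "x \<noteq> - real j" using assms by auto
  with j have "x \<in> Gamma_branch j" by (simp add: Gamma_branch_def)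
  then show ?thesis by (rule that)
qed

lemma Gamma_branch_convex:
  assumes "x \<in> Gamma_branch j" "y \<in> Gamma_branch j" "x \<le> t" "t \<le> y"
  shows "t \<in> Gamma_branch j"
  using assms by (auto simp: Gamma_branch_def)

lemma Digamma_branch_strict_mono:
  assumes "x \<in> Gamma_branch j" "y \<in> Gamma_branch j" "x < y"
  shows "Digamma x < Digamma y"
proof (rule DERIV_pos_imp_increasing[OF assms(3)])
  fix t assume "x \<le> t" "t \<le> y"
  then have t: "t \<notin> \<int>\<^sub>\<le>\<^sub>0"
    using Gamma_branch_convex[OF assms(1,2)] Gamma_branch_notin_nonpos_Ints by blast
  show "\<exists>d. (Digamma has_real_derivative d) (at t) \<and> d > 0"
    using has_field_derivative_Polygamma[OF t, of 0] Polygamma_real_odd_pos[OF t, of 1] by auto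
qed

lemma sgn_Gamma_branch:
  assumes "x \<in> Gamma_branch j"
  shows "(-1) ^ j * Gamma x > 0"
  using assms
proof (induction j arbitrary: x)
  case 0
  then show ?case by (simp add: Gamma_branch_def)
next
  case (Suc j)
  have x: "x \<notin> \<int>\<^sub>\<le>\<^sub>0" using Suc.prems by (rule Gamma_branch_notin_nonpos_Ints)
  have "x < 0" "x + 1 \<in> Gamma_branch j" using Suc.prems by (auto simp: Gamma_branch_def)
  from Suc.IH[OF this(2)] Gamma_plus1[OF x] have "x * ((-1) ^ j * Gamma x) > 0"
    by (simp add: mult_ac)
  with \<open>x < 0\<close> have "(-1) ^ j * Gamma x < 0" by (simp add: zero_less_mult_iff)
  then show ?case by simp
qed

lemma deriv_Gamma_eq_0_iff:
  assumes "x \<in> Gamma_branch j"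
  shows "deriv Gamma x = 0 \<longleftrightarrow> Digamma x = 0"
proof -
  have x: "x \<notin> \<int>\<^sub>\<le>\<^sub>0" using assms by (rule Gamma_branch_notin_nonpos_Ints)
  have "deriv Gamma x = Gamma x * Digamma x"
    by (rule DERIV_imp_deriv has_field_derivative_Gamma x)+
  with x show ?thesis by (simp add: Gamma_eq_zero_iff)
qed

text \<open>Rolle's theorem. The unbounded branch uses Gamma 1 = Gamma 2; the others use 1/Gamma,
  which is smooth up to the endpoints and vanishes there.\<close>

lemma ex_Digamma_zero: "\<exists>x \<in> Gamma_branch j. Digamma x = 0"
proof (cases "j = 0")
  case True
  have "\<exists>x>1. x < (2::real) \<and> DERIV Gamma x :> 0"
  proof (rule Rolle)
    show "Gamma 1 = Gamma (2::real)" using Gamma_numeral[of "num.Bit0 num.One"] by simp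
    show "continuous_on {1..2::real} Gamma"
      by (intro continuous_on_Gamma) (auto elim!: nonpos_Ints_cases)
    show "Gamma differentiable (at x)" if "1 < x" "x < 2" for x :: real
    proof -
      have "x \<notin> \<int>\<^sub>\<le>\<^sub>0" using that by (auto elim!: nonpos_Ints_cases)
      then show ?thesis unfolding real_differentiable_def by (blast intro: has_field_derivative_Gamma)
    qed
  qed auto
  then obtain x :: real where x: "x > 1" "DERIV Gamma x :> 0" by auto
  then have "x \<in> Gamma_branch j" using True by (simp add: Gamma_branch_def)
  with x deriv_Gamma_eq_0_iff show ?thesis using DERIV_imp_deriv by blast
next
  case False
  have "rGamma (- real j) = 0" by (simp add: rGamma_eq_zero_iff)
  moreover have "rGamma (- real (j - 1)) = 0" by (simp only: rGamma_eq_zero_iff) auto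
  moreover have "- real (j - 1) = - real j + 1" using False by simp
  ultimately have eq: "rGamma (- real j) = rGamma (- real j + 1)" by simp
  have "\<exists>x>- real j. x < - real j + 1 \<and> DERIV rGamma x :> 0"
  proof (rule Rolle[of "- real j" "- real j + 1" rGamma, OF _ eq])
    show "rGamma differentiable (at x)" for x :: real
      unfolding real_differentiable_def using has_field_derivative_rGamma by blast
  qed (auto intro: continuous_on_rGamma)
  then obtain x where x: "x > - real j" "x < - real j + 1" "DERIV rGamma x :> 0" by auto
  then have xb: "x \<in> Gamma_branch j" by (auto simp: Gamma_branch_def)
  then have xn: "x \<notin> \<int>\<^sub>\<le>\<^sub>0" by (rule Gamma_branch_notin_nonpos_Ints)
  have "rGamma x * Digamma x = 0"
    using DERIV_unique[OF x(3) has_field_derivative_rGamma_no_nonpos_int[OF xn]] by simp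
  with xn xb show ?thesis by (auto simp: rGamma_eq_zero_iff)
qed

text \<open>Licenses the definite descriptions in \<open>Gamma_crit\<close>: existence comes from
  Rolle, uniqueness from the monotonicity of \<open>Digamma\<close> on each branch.\<close>

lemma Gamma_crit: "Gamma_crit j \<in> Gamma_branch j" "Digamma (Gamma_crit j) = 0"
proof -
  have "\<exists>!x. x \<in> Gamma_branch j \<and> deriv Gamma x = 0"
  proof (rule ex_ex1I)
    show "\<exists>x. x \<in> Gamma_branch j \<and> deriv Gamma x = 0"
      using ex_Digamma_zero deriv_Gamma_eq_0_iff by blast
    fix x y assume "x \<in> Gamma_branch j \<and> deriv Gamma x = 0" "y \<in> Gamma_branch j \<and> deriv Gamma y = 0"
    then show "x = y"
      using Digamma_branch_strict_mono[of x j y] Digamma_branch_strict_mono[of y j x] deriv_Gamma_eq_0_iff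
      by (metis less_irrefl linorder_neqE)
  qed
  from theI'[OF this] have "(THE x. x \<in> Gamma_branch j \<and> deriv Gamma x = 0) \<in> Gamma_branch j"
    "deriv Gamma (THE x. x \<in> Gamma_branch j \<and> deriv Gamma x = 0) = 0" by auto
  moreover have "Gamma_crit j = (THE x. x \<in> Gamma_branch j \<and> deriv Gamma x = 0)"
    unfolding Gamma_crit_def Gamma_branch_def
    by (auto intro!: arg_cong[where f = The] simp: fun_eq_iff)
  ultimately show "Gamma_crit j \<in> Gamma_branch j" "Digamma (Gamma_crit j) = 0"
    using deriv_Gamma_eq_0_iff by auto
qed

lemma Digamma_sign_branch:
  assumes "x \<in> Gamma_branch j"
  shows "x < Gamma_crit j \<Longrightarrow> Digamma x < 0" "x > Gamma_crit j \<Longrightarrow> Digamma x > 0"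
  using Digamma_branch_strict_mono[OF assms Gamma_crit(1)]
    Digamma_branch_strict_mono[OF Gamma_crit(1) assms] Gamma_crit(2) by auto

text \<open>The logarithmic derivative \<open>Digamma\<close> of |Gamma| changes from negative to
  positive at the critical point. Hence real boundary values of the logarithm lie on the
  slits.\<close>

lemma abs_Gamma_crit_le:
  assumes "x \<in> Gamma_branch j"
  shows "\<bar>Gamma (Gamma_crit j)\<bar> \<le> \<bar>Gamma x\<bar>"
proof -
  define f where "f t = (-1) ^ j * Gamma t" for t :: real
  have f_abs: "f t = \<bar>Gamma t\<bar>" if "t \<in> Gamma_branch j" for t
    using sgn_Gamma_branch[OF that] by (cases "even j") (auto simp: f_def)
  have der: "(f has_real_derivative f t * Digamma t) (at t)" if "t \<in> Gamma_branch j" for t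
    unfolding f_def mult.assoc
    by (intro DERIV_cmult has_field_derivative_Gamma Gamma_branch_notin_nonpos_Ints[OF that])
  have "f (Gamma_crit j) \<le> f x"
  proof (cases "x \<le> Gamma_crit j")
    case True
    show ?thesis
    proof (rule DERIV_nonpos_imp_nonincreasing[OF True])
      fix t assume t: "x \<le> t" "t \<le> Gamma_crit j"
      then have tb: "t \<in> Gamma_branch j" using Gamma_branch_convex[OF assms Gamma_crit(1)] by blast
      have "Digamma t \<le> 0" using Digamma_sign_branch(1)[OF tb] Gamma_crit(2) t by (cases "t = Gamma_crit j") auto
      then show "\<exists>y. (f has_real_derivative y) (at t) \<and> y \<le> 0"
        using der[OF tb] f_abs[OF tb] by (intro exI[of _ "f t * Digamma t"]) (auto simp: mult_nonneg_nonpos)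
    qed
  next
    case False
    show ?thesis
    proof (rule DERIV_nonneg_imp_nondecreasing[of _ _ f])
      fix t assume t: "Gamma_crit j \<le> t" "t \<le> x"
      then have tb: "t \<in> Gamma_branch j" using Gamma_branch_convex[OF Gamma_crit(1) assms] by blast
      have "Digamma t \<ge> 0" using Digamma_sign_branch(2)[OF tb] Gamma_crit(2) t by (cases "t = Gamma_crit j") auto
      then show "\<exists>y. (f has_real_derivative y) (at t) \<and> 0 \<le> y"
        using der[OF tb] f_abs[OF tb] by (intro exI[of _ "f t * Digamma t"]) auto
    qed (use False in simp)
  qed
  then show ?thesis using f_abs assms Gamma_crit(1) by simp
qed

lemma exp_ln_Gamma_upper: "Im p > 0 \<Longrightarrow> exp (ln_Gamma p) = Gamma p"
  by (simp add: Gamma_complex_altdef Im_pos_notin_nonpos_Ints)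

section \<open>Bounded preimages and the image of the logarithm\<close>

lemma Re_less_2_if_Im_ln_Gamma_neg: "Im p > 0 \<Longrightarrow> Im (ln_Gamma p) < 0 \<Longrightarrow> Re p < 2"
  using Im_ln_Gamma_nonneg[of p] by linarith

text \<open>The imaginary part of \<open>p\<close> is controlled by the decay of Gamma, and then its
  real part by the imaginary part of the logarithm.\<close>

lemma bounded_vimage_ln_Gamma:
  "bounded {p. Im p > 0 \<and> Im (ln_Gamma p) < 0 \<and> norm (ln_Gamma p) \<le> M}"
proof -
  obtain C where C: "C > 0" "\<And>p::complex. Re p \<le> 2 \<Longrightarrow> 1 \<le> Im p \<Longrightarrow> (Im p)\<^sup>2 * norm (Gamma p) \<le> C"
    using norm_Gamma_decay by blast
  \<comment> \<open>Comes from |Gamma p| >= exp (-M) and (Im p)^2 |Gamma p| <= C, with Im p <= (Im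
    p)^2 once Im p >= 1.\<close>
  define Y where "Y = max 1 (C / exp (- M))"
  obtain V where V: "\<And>p. 0 < Im p \<Longrightarrow> Im p \<le> Y \<Longrightarrow> Re p \<le> 1 \<Longrightarrow> Im (ln_Gamma p) \<le> V + Re p * pi / 2"
    using Im_ln_Gamma_upper_bound by blast
  have "norm p \<le> 2 + 2 / pi * (\<bar>V\<bar> + \<bar>M\<bar>) + Y"
    if p: "Im p > 0" "Im (ln_Gamma p) < 0" "norm (ln_Gamma p) \<le> M" for p
  proof -
    have re: "Re p < 2" using p by (intro Re_less_2_if_Im_ln_Gamma_neg)
    have "Re (ln_Gamma p) \<ge> - M" "Im (ln_Gamma p) \<ge> - M"
      using abs_Re_le_cmod[of "ln_Gamma p"] abs_Im_le_cmod[of "ln_Gamma p"] p by linarith+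
    then have *: "norm (Gamma p) \<ge> exp (- M)"
      using p by (simp flip: exp_ln_Gamma_upper add: norm_exp_eq_Re)
    have im: "Im p \<le> Y"
    proof (cases "Im p \<ge> 1")
      case True
      have "Im p * exp (- M) \<le> (Im p)\<^sup>2 * norm (Gamma p)"
        using True * by (intro mult_mono) (auto simp: power2_eq_square)
      also have "\<dots> \<le> C" using re True by (intro C) auto
      finally have "Im p \<le> C / exp (- M)" by (simp add: pos_le_divide_eq)
      then show ?thesis by (simp add: Y_def)
    qed (simp add: Y_def)
    have "Re p \<ge> - (2 / pi * (\<bar>V\<bar> + \<bar>M\<bar>))"
    proof (cases "Re p \<le> 1")
      case True
      from V[OF p(1) im this] \<open>Im (ln_Gamma p) \<ge> - M\<close> have "- (\<bar>V\<bar> + \<bar>M\<bar>) \<le> Re p * pi / 2" by linarith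
      then show ?thesis by (simp add: field_simps)
    next
      case False
      moreover have "0 \<le> 2 / pi * (\<bar>V\<bar> + \<bar>M\<bar>)" by simp
      ultimately show ?thesis by linarith
    qed
    moreover have "0 \<le> 2 / pi * (\<bar>V\<bar> + \<bar>M\<bar>)" by simp
    ultimately have "\<bar>Re p\<bar> \<le> 2 + 2 / pi * (\<bar>V\<bar> + \<bar>M\<bar>)" using re by linarith
    moreover have "\<bar>Im p\<bar> \<le> Y" using im p by simp
    ultimately show ?thesis using cmod_le[of p] by linarith
  qed
  then show ?thesis by (intro boundedI) auto
qed

text \<open>Preimages are bounded, so a subsequence tends to some q in the closed half plane. It is
  no pole because 1/Gamma(q) = exp (-w) is nonzero, and not real because w would then lie on a
  slit.\<close>

lemma ln_Gamma_limit_in_image: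
  assumes p: "\<And>n::nat. Im (p n) > 0" "\<And>n. Im (ln_Gamma (p n)) < 0"
    and lim: "(\<lambda>n. ln_Gamma (p n)) \<longlonglongrightarrow> w"
    and slit: "\<And>j. Im w = - real j * pi \<Longrightarrow> Re w < ln \<bar>Gamma (Gamma_crit j)\<bar>"
  shows "w \<in> ln_Gamma ` upper_half_plane"
proof -
  obtain M where M: "\<And>n. norm (ln_Gamma (p n)) \<le> M"
    using convergent_imp_bounded[OF lim] by (auto simp: bounded_iff)
  have "bounded (range p)"
    by (rule bounded_subset[OF bounded_vimage_ln_Gamma[of M]]) (use p M in auto)
  then obtain q r where r: "strict_mono (r :: nat \<Rightarrow> nat)" and q: "(p \<circ> r) \<longlonglongrightarrow> q"
    using bounded_imp_convergent_subsequence by blast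
  have lim': "(\<lambda>n. ln_Gamma (p (r n))) \<longlonglongrightarrow> w"
    using LIMSEQ_subseq_LIMSEQ[OF lim r] by (simp add: o_def)
  have q: "(\<lambda>n. p (r n)) \<longlonglongrightarrow> q" using q by (simp add: o_def)
  \<comment> \<open>The entire function 1/Gamma is used because q might still be a pole of Gamma at
    this stage.\<close>
  have rG: "rGamma q = exp (- w)"
  proof (rule LIMSEQ_unique)
    show "(\<lambda>n. rGamma (p (r n))) \<longlonglongrightarrow> rGamma q"
      using isCont_tendsto_compose[OF isCont_rGamma[OF continuous_ident] q] by simp
    show "(\<lambda>n. rGamma (p (r n))) \<longlonglongrightarrow> exp (- w)"
      using tendsto_exp[OF tendsto_minus[OF lim']] p by (simp add: rGamma_complex_altdef Im_pos_notin_nonpos_Ints)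
  qed
  then have qG: "exp w = Gamma q" by (simp add: Gamma_def exp_minus)
  have qn: "q \<notin> \<int>\<^sub>\<le>\<^sub>0" using rG by (metis exp_not_eq_zero rGamma_eq_zero_iff)
  have "Im q \<ge> 0"
    by (rule tendsto_lowerbound[OF tendsto_Im[OF q] always_eventually])
      (simp_all add: p(1) less_imp_le)
  moreover have "Im q \<noteq> 0"
  proof
    assume "Im q = 0"
    then obtain x where x: "q = complex_of_real x" by (metis complex_is_Real_iff Reals_cases)
    then have "x \<notin> \<int>\<^sub>\<le>\<^sub>0" using qn by (auto elim!: nonpos_Ints_cases simp: nonpos_Ints_def)
    then obtain j where j: "x \<in> Gamma_branch j" using Gamma_branch_exhaust by blast
    have "filterlim (\<lambda>n. p (r n)) (at (complex_of_real x) within upper_half_plane) sequentially"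
      unfolding filterlim_at
    proof (intro conjI always_eventually allI)
      show "p (r n) \<in> upper_half_plane" for n using p(1) by (simp add: upper_half_plane_def)
      show "p (r n) \<noteq> of_real x" for n using p(1)[of "r n"] by auto
    qed (use q x in simp)
    then have "(\<lambda>n. Im (ln_Gamma (p (r n)))) \<longlonglongrightarrow> - real j * pi"
      by (rule filterlim_compose[OF tendsto_Im_ln_Gamma_real, rotated -1])
        (use j in \<open>auto simp: Gamma_branch_def\<close>)
    then have "Im w = - real j * pi"
      using LIMSEQ_unique tendsto_Im[OF lim'] by blast
    then have "Re w < ln \<bar>Gamma (Gamma_crit j)\<bar>" by (rule slit)
    also have "\<dots> \<le> ln \<bar>Gamma x\<bar>"
      using abs_Gamma_crit_le[OF j] Gamma_branch_notin_nonpos_Ints[OF Gamma_crit(1)] \<open>x \<notin> \<int>\<^sub>\<le>\<^sub>0\<close>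
      by (subst ln_le_cancel_iff) (auto simp: Gamma_eq_zero_iff intro: less_le_trans[rotated])
    also have "\<bar>Gamma x\<bar> = exp (Re w)"
      using arg_cong[OF qG, of norm] x by (simp add: norm_exp_eq_Re Gamma_complex_of_real)
    finally show False by simp
  qed
  ultimately have "Im q > 0" by simp
  then have "(\<lambda>n. ln_Gamma (p (r n))) \<longlonglongrightarrow> ln_Gamma q"
    using isCont_tendsto_compose[OF isCont_ln_Gamma_complex[OF continuous_ident] q] Im_pos_notin_nonpos_Reals by blast
  then have "w = ln_Gamma q" using LIMSEQ_unique lim' by blast
  with \<open>Im q > 0\<close> show ?thesis by (auto simp: upper_half_plane_def)
qed

lemma open_ln_Gamma_image: "open (ln_Gamma ` upper_half_plane)"
  by (rule open_mapping_thm3[OF ln_Gamma_holomorphic_upper open_upper_half_plane inj_on_ln_Gamma])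

text \<open>Intermediate values along the line Im = 1, from 2 + i, where the imaginary part is
  nonnegative, to the far left. It supplies a starting point in each strip.\<close>

lemma Im_ln_Gamma_surj:
  assumes "c \<le> 0"
  shows "\<exists>p. Im p > 0 \<and> Im (ln_Gamma p) = c"
proof -
  obtain V where V: "\<And>p. 0 < Im p \<Longrightarrow> Im p \<le> 1 \<Longrightarrow> Re p \<le> 1 \<Longrightarrow> Im (ln_Gamma p) \<le> V + Re p * pi / 2"
    using Im_ln_Gamma_upper_bound by blast
  \<comment> \<open>Solves V + a pi/2 = c; the minimum with 1 keeps the point in the range of the
    bound.\<close>
  define a where "a = min 1 ((c - V) * 2 / pi)"
  have "Im (ln_Gamma (Complex a 1)) \<le> V + a * pi / 2" using V[of "Complex a 1"] by (simp add: a_def)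
  also have "\<dots> \<le> V + ((c - V) * 2 / pi) * pi / 2"
    by (intro add_left_mono divide_right_mono mult_right_mono) (auto simp: a_def)
  also have "\<dots> = c" by (simp add: field_simps)
  finally have le: "Im (ln_Gamma (Complex a 1)) \<le> c" .
  have ge: "c \<le> Im (ln_Gamma (Complex 2 1))" using Im_ln_Gamma_nonneg[of "Complex 2 1"] assms by simp
  have "continuous_on {a..2} (\<lambda>t. Im (ln_Gamma (of_real t + \<i>)))"
    by (intro continuous_intros continuous_on_compose2[OF continuous_on_ln_Gamma_complex[of upper_half_plane]])
      (use Im_pos_notin_nonpos_Reals in \<open>auto simp: upper_half_plane_def\<close>)
  then have "continuous_on {a..2} (\<lambda>t. Im (ln_Gamma (Complex t 1)))" by (simp add: Complex_eq)
  from IVT'[of "\<lambda>t. Im (ln_Gamma (Complex t 1))", OF le ge _ this]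
  have "a \<le> 2 \<Longrightarrow> \<exists>t. Im (ln_Gamma (Complex t 1)) = c" by blast
  moreover have "a \<le> 2" by (simp add: a_def)
  ultimately obtain t where "Im (ln_Gamma (Complex t 1)) = c" by blast
  then show ?thesis by (intro exI[of _ "Complex t 1"]) simp
qed

text \<open>The strip lies between two consecutive slit lines, so the slit hypothesis of
  \<open>ln_Gamma_limit_in_image\<close> is vacuous and the image is relatively closed. It is also
  relatively open and nonempty, and the strip is connected.\<close>

lemma strip_subset_ln_Gamma_image:
  fixes k :: nat
  shows "{w. - (real k + 1) * pi < Im w \<and> Im w < - real k * pi} \<subseteq> ln_Gamma ` upper_half_plane"
    (is "?S \<subseteq> ?V")
proof -
  have S_eq: "?S = {w. Im w > - (real k + 1) * pi} \<inter> {w. Im w < - real k * pi}" by auto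
  have conn: "connected ?S"
    unfolding S_eq by (intro convex_connected convex_Int convex_halfspace_Im_gt convex_halfspace_Im_lt)
  have neg: "Im w < 0" if "w \<in> ?S" for w
  proof -
    have "Im w < - real k * pi" using that by simp
    also have "\<dots> \<le> 0" by simp
    finally show ?thesis .
  qed
  have no_slit: "Im w \<noteq> - real j * pi" if "w \<in> ?S" for w j
  proof
    assume "Im w = - real j * pi"
    then have "real k * pi < real j * pi" "real j * pi < real (k + 1) * pi"
      using that by (auto simp: algebra_simps)
    then show False by (simp only: mult_less_cancel_right_pos[OF pi_gt_zero] of_nat_less_iff)
  qed
  have "closedin (top_of_set ?S) (?S \<inter> ?V)"
    unfolding closedin_limpt
  proof (intro conjI allI impI)
    fix w assume w: "w islimpt (?S \<inter> ?V) \<and> w \<in> ?S"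
    then obtain f where f: "\<And>n::nat. f n \<in> ?S \<inter> ?V - {w}" "f \<longlonglongrightarrow> w"
      unfolding islimpt_sequential by blast
    then have "\<forall>n. \<exists>p. Im p > 0 \<and> f n = ln_Gamma p" by (fastforce simp: upper_half_plane_def)
    then obtain p where p: "\<And>n. Im (p n) > 0 \<and> f n = ln_Gamma (p n)" by metis
    have "w \<in> ?V"
    proof (rule ln_Gamma_limit_in_image[of p])
      show "Im (ln_Gamma (p n)) < 0" for n using f(1)[of n] p[of n] neg by auto
      have "f = (\<lambda>n. ln_Gamma (p n))" using p by auto
      with f(2) show "(\<lambda>n. ln_Gamma (p n)) \<longlonglongrightarrow> w" by simp
    qed (use p no_slit[of w] w in blast)+
    with w show "w \<in> ?S \<inter> ?V" by auto
  qed auto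
  moreover have "openin (top_of_set ?S) (?S \<inter> ?V)" using open_ln_Gamma_image by blast
  moreover have "?S \<inter> ?V \<noteq> {}"
  proof -
    define c where "c = - (real k + 1 / 2) * pi"
    have "c \<le> 0" by (simp add: c_def mult_nonpos_nonneg)
    then obtain p where p: "Im p > 0" "Im (ln_Gamma p) = c" using Im_ln_Gamma_surj by blast
    have "- (real k + 1) * pi < c" "c < - real k * pi"
      unfolding c_def by (intro mult_strict_right_mono; simp)+
    then have "ln_Gamma p \<in> ?S \<inter> ?V" using p by (auto simp: upper_half_plane_def)
    then show ?thesis by blast
  qed
  ultimately have "?S \<inter> ?V = ?S" using conn unfolding connected_clopen by blast
  then show ?thesis by blast
qed

section \<open>Boundary behaviour and extension of the inverse\<close>

text \<open>On a ball where Re f' > 0 the function is injective, and Im f increases along vertical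
  segments. As f is real on the axis, Im f has the sign of Im z, so the inverse respects the axis
  and its upper side.\<close>

lemma real_local_inverse:
  fixes f :: "complex \<Rightarrow> complex" and x :: real
  assumes holo: "f holomorphic_on U" and "open U" and xU: "of_real x \<in> U"
    and real: "\<And>t::real. of_real t \<in> U \<Longrightarrow> Im (f (of_real t)) = 0"
    and pos: "Re (deriv f (of_real x)) > 0"
  obtains N \<phi> where "open N" "f (of_real x) \<in> N" "\<phi> holomorphic_on N" "\<phi> (f (of_real x)) = of_real x"
    "\<And>s. s \<in> N \<Longrightarrow> \<phi> s \<in> U" "\<And>s. s \<in> N \<Longrightarrow> f (\<phi> s) = s"
    "\<And>s. s \<in> N \<Longrightarrow> Im s > 0 \<Longrightarrow> Im (\<phi> s) > 0" "\<And>s. s \<in> N \<Longrightarrow> Im s = 0 \<Longrightarrow> Im (\<phi> s) = 0"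
proof -
  define c where "c = complex_of_real x"
  have "continuous_on U (\<lambda>z. Re (deriv f z))"
    using holomorphic_deriv[OF holo \<open>open U\<close>] holomorphic_on_imp_continuous_on by (intro continuous_intros) auto
  then have "open {z \<in> U. Re (deriv f z) > 0}"
    using continuous_open_preimage[OF _ \<open>open U\<close> open_greaterThan[of 0]]
    by (simp add: vimage_def Int_def conj_commute)
  moreover have "c \<in> {z \<in> U. Re (deriv f z) > 0}" using xU pos by (simp add: c_def)
  ultimately obtain e where e: "e > 0" "ball c e \<subseteq> {z \<in> U. Re (deriv f z) > 0}"
    using openE by blast
  define B where "B = ball c e"
  have BU: "B \<subseteq> U" and Bpos: "\<And>z. z \<in> B \<Longrightarrow> Re (deriv f z) > 0" using e by (auto simp: B_def)
  have der: "(f has_field_derivative deriv f z) (at z)" if "z \<in> B" for z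
    using holomorphic_derivI[OF holo \<open>open U\<close>] that BU by blast
  have inj: "inj_on f B"
    by (rule inj_on_convex_linear_deriv_pos[where f' = "deriv f" and c = 1])
      (use der Bpos in \<open>auto simp: B_def\<close>)
  have holoB: "f holomorphic_on B" using holo BU by (rule holomorphic_on_subset)
  have openB: "open B" by (simp add: B_def)
  obtain \<phi> where \<phi>: "\<phi> holomorphic_on (f ` B)" "\<And>z. z \<in> B \<Longrightarrow> \<phi> (f z) = z"
    using holomorphic_has_inverse[OF holoB openB inj] by metis
  have cB: "c \<in> B" using e by (simp add: B_def)
  have sgn: "sgn (Im (f z)) = sgn (Im z)" if z: "z \<in> B" for z
  proof -
    define u where "u t = Im (f (Complex (Re z) t))" for t
    \<comment> \<open>The centre is real, so moving vertically towards the axis does not leave the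
      ball.\<close>
    have inB: "Complex (Re z) t \<in> B" if "\<bar>t\<bar> \<le> \<bar>Im z\<bar>" for t
    proof -
      have "norm (c - Complex (Re z) t) \<le> norm (c - z)"
        unfolding cmod_def using that by (simp add: c_def abs_le_square_iff)
      then show ?thesis using z by (simp add: B_def dist_norm)
    qed
    have "Im (f (Complex (Re z) 0)) = 0"
      using real[of "Re z"] inB[of 0] BU by (auto simp: complex_of_real_def)
    then have u0: "u 0 = 0" by (simp add: u_def)
    have du: "\<exists>d. (u has_real_derivative d) (at t) \<and> d > 0" if "\<bar>t\<bar> \<le> \<bar>Im z\<bar>" for t
    proof -
      have "((\<lambda>t. of_real (Re z) + of_real t * \<i>) has_vector_derivative \<i>) (at t)"
        by (auto intro!: derivative_eq_intros)
      then have "(Complex (Re z) has_vector_derivative \<i>) (at t)"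
        by (simp add: Complex_eq[abs_def] mult.commute)
      then have "((\<lambda>t. f (Complex (Re z) t)) has_vector_derivative \<i> * deriv f (Complex (Re z) t)) (at t)"
        using field_vector_diff_chain_at der[OF inB[OF that]] by (fastforce simp: o_def)
      then have "(u has_real_derivative Im (\<i> * deriv f (Complex (Re z) t))) (at t)"
        unfolding u_def has_real_derivative_iff_has_vector_derivative
        by (rule bounded_linear.has_vector_derivative[OF bounded_linear_Im])
      then show ?thesis using Bpos[OF inB[OF that]] by auto
    qed
    have uz: "u (Im z) = Im (f z)" by (simp add: u_def)
    consider "Im z > 0" | "Im z = 0" | "Im z < 0" by linarith
    then show ?thesis
    proof cases
      case 1
      have "u 0 < u (Im z)" by (rule DERIV_pos_imp_increasing[OF 1]) (use du 1 in auto)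
      then show ?thesis using u0 uz 1 by simp
    next
      case 2
      then show ?thesis using u0 uz by simp
    next
      case 3
      have "u (Im z) < u 0" by (rule DERIV_pos_imp_increasing[OF 3]) (use du 3 in auto)
      then show ?thesis using u0 uz 3 by simp
    qed
  qed
  show ?thesis
  proof (rule that[of "f ` B" \<phi>])
    show "open (f ` B)" by (rule open_mapping_thm3[OF holoB openB inj])
    show "Im (\<phi> s) > 0" if "s \<in> f ` B" "Im s > 0" for s
      using that \<phi>(2) sgn by (metis imageE sgn_greater)
    show "Im (\<phi> s) = 0" if "s \<in> f ` B" "Im s = 0" for s
      using that \<phi>(2) sgn by (metis imageE sgn_eq_0_iff)
  qed (use \<phi> cB BU in \<open>auto simp: c_def\<close>)
qed

text \<open>The derivative of 1/Gamma is -\<open>Digamma\<close>/Gamma. As k is even, Gamma < 0 <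
  \<open>Digamma\<close> left of the pole -k and the signs are reversed right of it; at the pole the
  derivative is (-1)^k k!.\<close>

lemma deriv_rGamma_between_crit:
  assumes "even k" "Gamma_crit (Suc k) < x" "x < Gamma_crit k"
  shows "Re (deriv rGamma (complex_of_real x)) > 0"
proof (cases "x = - real k")
  case True
  have "deriv rGamma (- of_nat k) = (-1) ^ k * (fact k :: complex)"
    by (rule DERIV_imp_deriv[OF has_field_derivative_rGamma_nonpos_int])
  then show ?thesis using True assms(1) by simp
next
  case False
  have crit: "Gamma_crit k \<in> Gamma_branch k" "Gamma_crit (Suc k) \<in> Gamma_branch (Suc k)"
    by (rule Gamma_crit)+
  have sgn: "rGamma x * Digamma x < 0 \<and> x \<notin> \<int>\<^sub>\<le>\<^sub>0"
  proof (cases "x > - real k")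
    case True
    then have b: "x \<in> Gamma_branch k" using crit assms by (auto simp: Gamma_branch_def)
    then show ?thesis
      using sgn_Gamma_branch[OF b] Digamma_sign_branch(1)[OF b assms(3)] assms(1)
        Gamma_branch_notin_nonpos_Ints[OF b]
      by (simp add: rGamma_inverse_Gamma mult_pos_neg)
  next
    case False
    then have b: "x \<in> Gamma_branch (Suc k)" using crit assms \<open>x \<noteq> - real k\<close> by (auto simp: Gamma_branch_def)
    then show ?thesis
      using sgn_Gamma_branch[OF b] Digamma_sign_branch(2)[OF b assms(2)] assms(1)
        Gamma_branch_notin_nonpos_Ints[OF b]
      by (simp add: rGamma_inverse_Gamma mult_neg_pos)
  qed
  then have "complex_of_real x \<notin> \<int>\<^sub>\<le>\<^sub>0" "x \<noteq> 0"
    by (auto simp: nonpos_Ints_def) (metis of_real_eq_iff of_real_of_int_eq)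
  then have "deriv rGamma (complex_of_real x) = - rGamma (of_real x) * Digamma (of_real x)"
    by (intro DERIV_imp_deriv has_field_derivative_rGamma_no_nonpos_int)
  also have "\<dots> = of_real (- (rGamma x * Digamma x))"
    using \<open>x \<noteq> 0\<close> by (simp add: rGamma_complex_of_real Polygamma_of_real)
  finally show ?thesis using sgn by simp
qed

section \<open>The maps g_k and their continuation across the real line\<close>

lemma inv_ln_Gamma_ln_Gamma: "Im p > 0 \<Longrightarrow> inv_ln_Gamma (ln_Gamma p) = p"
  unfolding inv_ln_Gamma_def
  by (rule the_inv_into_f_f[OF inj_on_ln_Gamma]) (simp add: upper_half_plane_def)

text \<open>The source of Gamma(g_k(z)) = -z: the shift is an odd multiple of pi i.\<close>

lemma exp_minus_odd_pi:
  assumes "even k" "z \<noteq> 0"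
  shows "exp (Ln z - \<i> * (of_int (int k) + 1) * of_real pi) = - z"
proof -
  have "exp (\<i> * (of_int (int k) + 1) * of_real pi) = exp (of_nat (Suc k) * (of_real pi * \<i>))"
    by (simp add: algebra_simps)
  also have "\<dots> = -1" using assms(1) by (simp only: exp_of_nat_mult exp_pi_i) simp
  finally show ?thesis using assms(2) by (simp add: exp_diff)
qed

text \<open>With s = -1/z the equation Gamma(p) = -z reads 1/Gamma(p) = s, so a local inverse of
  1/Gamma is a candidate for g_k. It is the right branch because the two logarithms have equal
  exponentials and imaginary parts less than 2 pi apart. The case x = -k, s = 0 stands for z =
  infinity.\<close>

lemma g_upper_local_inverse:
  assumes k: "even k" and x: "Gamma_crit (Suc k) < x" "x < Gamma_crit k"
  obtains N \<phi> where "open N" "of_real (rGamma x) \<in> N" "\<phi> holomorphic_on N"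
    "\<phi> (of_real (rGamma x)) = of_real x"
    "\<And>s. s \<in> N \<Longrightarrow> Im s > 0 \<Longrightarrow> g_upper (int k) (- 1 / s) = \<phi> s"
    "\<And>s. s \<in> N \<Longrightarrow> Im s = 0 \<Longrightarrow> Im (\<phi> s) = 0"
proof -
  have "x + real k + 1 > 0" "k > 0 \<Longrightarrow> x + real k < 1"
    using Gamma_crit(1)[of k] Gamma_crit(1)[of "Suc k"] x by (auto simp: Gamma_branch_def)
  from eventually_Im_ln_Gamma_near_pole[OF this] obtain d where d: "d > 0"
    "\<And>\<zeta>. \<zeta> \<noteq> of_real x \<Longrightarrow> dist \<zeta> (of_real x) < d \<Longrightarrow> Im \<zeta> > 0 \<Longrightarrow>
      - (real k + 2) * pi < Im (ln_Gamma \<zeta>) \<and> Im (ln_Gamma \<zeta>) < (1 - real k) * pi"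
    unfolding eventually_at by blast
  define U where "U = ball (complex_of_real x) d"
  have U: "open U" "complex_of_real x \<in> U" using d by (auto simp: U_def)
  have real: "Im (rGamma (complex_of_real t)) = 0" for t by (simp add: rGamma_complex_of_real)
  obtain N \<phi> where N: "open N" "rGamma (complex_of_real x) \<in> N" "\<phi> holomorphic_on N"
    "\<phi> (rGamma (complex_of_real x)) = of_real x"
    "\<And>s. s \<in> N \<Longrightarrow> \<phi> s \<in> U" "\<And>s. s \<in> N \<Longrightarrow> rGamma (\<phi> s) = s"
    "\<And>s. s \<in> N \<Longrightarrow> Im s > 0 \<Longrightarrow> Im (\<phi> s) > 0" "\<And>s. s \<in> N \<Longrightarrow> Im s = 0 \<Longrightarrow> Im (\<phi> s) = 0"
    using real_local_inverse[OF holomorphic_rGamma U real deriv_rGamma_between_crit[OF k x]] by metis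
  show ?thesis
  proof (rule that[of N \<phi>])
    fix s assume s: "s \<in> N" "Im s > 0"
    define z where "z = - 1 / s"
    define p where "p = \<phi> s"
    have s0: "s \<noteq> 0" using s by auto
    have z: "Im z > 0" using s by (simp add: z_def Im_divide sum_power2_gt_zero_iff)
    have p: "Im p > 0" "p \<in> U" using N s by (auto simp: p_def)
    have v: "- (real k + 2) * pi < Im (ln_Gamma p) \<and> Im (ln_Gamma p) < (1 - real k) * pi"
      using p by (intro d) (auto simp: U_def dist_commute)
    have "exp (ln_Gamma p) = Gamma p" using p by (intro exp_ln_Gamma_upper)
    also have "Gamma p = - z" using N(6)[OF s(1)] by (simp add: Gamma_def p_def z_def divide_inverse)
    also have "- z = exp (Ln z - \<i> * (of_int (int k) + 1) * of_real pi)"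
      using z k by (subst exp_minus_odd_pi) auto
    finally have "ln_Gamma p = Ln z - \<i> * (of_int (int k) + 1) * of_real pi"
    proof (rule exp_complex_eqI[rotated])
      show "\<bar>Im (ln_Gamma p) - Im (Ln z - \<i> * (of_int (int k) + 1) * complex_of_real pi)\<bar> < 2 * pi"
        using v Im_Ln_pos_lt_imp[OF z] by (simp add: algebra_simps abs_less_iff)
    qed
    then have "g_upper (int k) z = p"
      unfolding g_upper_def using inv_ln_Gamma_ln_Gamma[OF p(1)] by metis
    then show "g_upper (int k) (- 1 / s) = \<phi> s" by (simp add: z_def p_def)
  qed (use N in \<open>auto simp: rGamma_complex_of_real\<close>)
qed

lemma Gamma_crit_sign:
  assumes "even k"
  shows "Gamma (Gamma_crit k) > 0" "Gamma (Gamma_crit (Suc k)) < 0"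
  using sgn_Gamma_branch[OF Gamma_crit(1)[of k]] sgn_Gamma_branch[OF Gamma_crit(1)[of "Suc k"]] assms
  by auto

lemma Gamma_crit_around_pole:
  "Gamma_crit (Suc k) < - real k" "- real k < Gamma_crit k"
  using Gamma_crit(1)[of k] Gamma_crit(1)[of "Suc k"] by (auto simp: Gamma_branch_def)

text \<open>Off I_k the value -1/t lies strictly between 1/Gamma(x_(k+1)) < 0 and 1/Gamma(x_k) > 0,
  so the intermediate value theorem applies.\<close>

lemma ex_rGamma_preimage:
  assumes k: "even k" and t: "t \<notin> I_cut k"
  obtains x where "Gamma_crit (Suc k) < x" "x < Gamma_crit k" "rGamma x = - 1 / t"
proof -
  let ?a = "Gamma_crit (Suc k)" and ?b = "Gamma_crit k" and ?s = "- 1 / t"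
  note sg = Gamma_crit_sign[OF k]
  have ab: "?a < ?b" using Gamma_crit_around_pole[of k] by linarith
  have "rGamma ?a < ?s \<and> ?s < rGamma ?b"
  proof (cases "t < - Gamma ?b")
    case True
    then have "?s > 0" "?s < rGamma ?b" using sg
      by (auto simp: rGamma_inverse_Gamma field_simps divide_neg_neg)
    moreover have "rGamma ?a < 0" using sg by (simp add: rGamma_inverse_Gamma)
    ultimately show ?thesis by linarith
  next
    case False
    then have "t > - Gamma ?a" using t sg by (auto simp: I_cut_def)
    then have "?s < 0" "rGamma ?a < ?s" using sg
      by (auto simp: rGamma_inverse_Gamma field_simps)
    moreover have "rGamma ?b > 0" using sg by (simp add: rGamma_inverse_Gamma)
    ultimately show ?thesis by linarith
  qed
  then have s: "rGamma ?a < ?s" "?s < rGamma ?b" by auto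
  obtain x where x: "?a \<le> x" "x \<le> ?b" "rGamma x = ?s"
    using IVT'[of rGamma ?a ?s ?b] s ab continuous_on_rGamma by (metis less_imp_le)
  have "x \<noteq> ?a" "x \<noteq> ?b" using x(3) s by auto
  with x show ?thesis by (intro that[of x]) auto
qed

lemma Ln_shift_in_ln_Gamma_image:
  assumes "Im z > 0"
  shows "Ln z - \<i> * (of_int (int k) + 1) * of_real pi \<in> ln_Gamma ` upper_half_plane"
  using strip_subset_ln_Gamma_image[of k] Im_Ln_pos_lt_imp[OF assms] by (force simp: algebra_simps)

text \<open>The argument of \<open>inv_ln_Gamma\<close> lies in a strip inside the image, so a true
  preimage is returned.\<close>

lemma g_upper_props:
  assumes "Im z > 0"
  shows "Im (g_upper (int k) z) > 0"
    "ln_Gamma (g_upper (int k) z) = Ln z - \<i> * (of_int (int k) + 1) * of_real pi"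
proof -
  obtain p where p: "Im p > 0" "ln_Gamma p = Ln z - \<i> * (of_int (int k) + 1) * of_real pi"
    using Ln_shift_in_ln_Gamma_image[OF assms, of k] unfolding upper_half_plane_def image_def by force
  then have "g_upper (int k) z = p" using inv_ln_Gamma_ln_Gamma by (metis g_upper_def)
  with p show "Im (g_upper (int k) z) > 0"
    "ln_Gamma (g_upper (int k) z) = Ln z - \<i> * (of_int (int k) + 1) * of_real pi" by auto
qed

lemma Im_ln_Gamma_g_upper_neg:
  assumes "Im z > 0"
  shows "Im (ln_Gamma (g_upper (int k) z)) < 0"
proof -
  have "Im (ln_Gamma (g_upper (int k) z)) = Im (Ln z) - pi - real k * pi"
    using arg_cong[OF g_upper_props(2)[OF assms, of k], of Im] by (simp add: algebra_simps)
  moreover have "real k * pi \<ge> 0" by simp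
  ultimately show ?thesis using Im_Ln_pos_lt_imp[OF assms] by linarith
qed

lemma holomorphic_inv_ln_Gamma: "inv_ln_Gamma holomorphic_on ln_Gamma ` upper_half_plane"
proof -
  obtain g where g: "g holomorphic_on ln_Gamma ` upper_half_plane"
    "\<And>z. z \<in> upper_half_plane \<Longrightarrow> g (ln_Gamma z) = z"
    using holomorphic_has_inverse[OF ln_Gamma_holomorphic_upper open_upper_half_plane inj_on_ln_Gamma] by metis
  have "inv_ln_Gamma w = g w" if "w \<in> ln_Gamma ` upper_half_plane" for w
    using that g(2) inv_ln_Gamma_ln_Gamma by (auto simp: upper_half_plane_def)
  with g(1) show ?thesis by (simp cong: holomorphic_cong)
qed

lemma holomorphic_g_upper: "g_upper (int k) holomorphic_on upper_half_plane"
proof -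
  have "(inv_ln_Gamma \<circ> (\<lambda>z. Ln z - \<i> * (of_int (int k) + 1) * of_real pi)) holomorphic_on upper_half_plane"
    by (rule holomorphic_on_compose_gen[OF _ holomorphic_inv_ln_Gamma])
      (use Ln_shift_in_ln_Gamma_image Im_pos_notin_nonpos_Reals in \<open>auto intro!: holomorphic_intros simp: upper_half_plane_def\<close>)
  then show ?thesis by (simp add: g_upper_def[abs_def] o_def)
qed

text \<open>Makes limits from the half plane unique, so that \<open>Lim\<close> can be evaluated at
  real points.\<close>

lemma upper_half_plane_limit:
  fixes t :: real
  shows "at (complex_of_real t) within upper_half_plane \<noteq> bot"
proof -
  have "(\<lambda>n. of_real t + \<i> * of_real (1 / real (Suc n))) \<longlonglongrightarrow> of_real t + \<i> * of_real 0"
    by (intro tendsto_intros LIMSEQ_Suc lim_1_over_n)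
  then show ?thesis
    unfolding trivial_limit_within islimpt_sequential not_not
    by (intro exI[of _ "\<lambda>n. of_real t + \<i> * of_real (1 / real (Suc n))"])
      (auto simp: upper_half_plane_def complex_eq_iff)
qed

text \<open>Pulls the local inverse back along z -> -1/z. Continuity across t and real values on the
  axis are what Schwarz reflection demands.\<close>

lemma g_upper_continuation:
  assumes k: "even k" and t: "t \<notin> I_cut k"
  obtains W \<psi> where "open W" "of_real t \<in> W" "continuous_on W \<psi>"
    "\<And>z. z \<in> W \<Longrightarrow> Im z > 0 \<Longrightarrow> g_upper (int k) z = \<psi> z"
    "\<And>z. z \<in> W \<Longrightarrow> Im z = 0 \<Longrightarrow> Im (\<psi> z) = 0"
proof -
  obtain x where x: "Gamma_crit (Suc k) < x" "x < Gamma_crit k" "rGamma x = - 1 / t"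
    by (rule ex_rGamma_preimage[OF k t])
  obtain N \<phi> where N: "open N" "of_real (rGamma x) \<in> N" "\<phi> holomorphic_on N"
    "\<phi> (of_real (rGamma x)) = of_real x"
    "\<And>s. s \<in> N \<Longrightarrow> Im s > 0 \<Longrightarrow> g_upper (int k) (- 1 / s) = \<phi> s"
    "\<And>s. s \<in> N \<Longrightarrow> Im s = 0 \<Longrightarrow> Im (\<phi> s) = 0"
    by (rule g_upper_local_inverse[OF k x(1,2)]) metis
  have "0 \<in> I_cut k" using Gamma_crit_sign[OF k] by (simp add: I_cut_def)
  then have t0: "t \<noteq> 0" using t by auto
  define W where "W = {z \<in> - {0}. - 1 / z \<in> N}"
  have cont: "continuous_on (- {0}) (\<lambda>z::complex. - 1 / z)" by (intro continuous_intros) auto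
  have "open W"
    unfolding W_def using continuous_open_preimage[OF cont _ N(1)]
    by (simp add: vimage_def Int_def open_Compl)
  moreover have "of_real t \<in> W" using t0 N(2) x(3) by (simp add: W_def)
  moreover have "continuous_on W (\<lambda>z. \<phi> (- 1 / z))"
    by (rule continuous_on_compose2[OF holomorphic_on_imp_continuous_on[OF N(3)] continuous_on_subset[OF cont]])
      (auto simp: W_def)
  moreover have "g_upper (int k) z = \<phi> (- 1 / z)" if "z \<in> W" "Im z > 0" for z
  proof -
    have "Im (- 1 / z) > 0" using that by (simp add: Im_divide sum_power2_gt_zero_iff)
    with N(5)[of "- 1 / z"] that show ?thesis by (simp add: W_def)
  qed
  moreover have "Im (\<phi> (- 1 / z)) = 0" if "z \<in> W" "Im z = 0" for z
  proof -
    have "Im (- 1 / z) = 0" using that by (simp add: Im_divide)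
    with N(6)[of "- 1 / z"] that show ?thesis by (simp add: W_def)
  qed
  ultimately show ?thesis by (rule that)
qed

lemma is_g_extension_exists:
  assumes k: "even k"
  shows "\<exists>h. is_g_extension k h"
proof -
  \<comment> \<open>\<open>h\<close> below reads \<open>f\<close> only in the closed upper half
    plane: at real points off I_k the limit exists by \<open>g_upper_continuation\<close>, and on
    I_k the value is arbitrary.\<close>
  define S where "S = - complex_of_real ` I_cut k"
  define f where "f z = (if Im z > 0 then g_upper (int k) z
     else Lim (at z within upper_half_plane) (g_upper (int k)))" for z
  define h where "h z = (if 0 \<le> Im z then f z else cnj (f (cnj z)))" for z
  have f_local: "\<exists>W \<psi>. open W \<and> z \<in> W \<and> continuous_on W \<psi> \<and>
      (\<forall>z\<in>W. Im z \<ge> 0 \<longrightarrow> f z = \<psi> z) \<and> Im (\<psi> z) = 0"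
    if z: "z \<in> S" "Im z = 0" for z
  proof -
    obtain t where t: "z = complex_of_real t" using z(2) by (metis complex_is_Real_iff Reals_cases)
    then have "t \<notin> I_cut k" using z by (auto simp: S_def)
    then obtain W \<psi> where W: "open W" "of_real t \<in> W" "continuous_on W \<psi>"
      "\<And>z. z \<in> W \<Longrightarrow> Im z > 0 \<Longrightarrow> g_upper (int k) z = \<psi> z"
      "\<And>z. z \<in> W \<Longrightarrow> Im z = 0 \<Longrightarrow> Im (\<psi> z) = 0"
      using g_upper_continuation[OF k] by metis
    have "f w = \<psi> w" if w: "w \<in> W" "Im w \<ge> 0" for w
    proof (cases "Im w > 0")
      case False
      with w have "Im w = 0" by simp
      then obtain u where u: "w = complex_of_real u" by (metis complex_is_Real_iff Reals_cases)
      have "(\<psi> \<longlongrightarrow> \<psi> w) (at w within upper_half_plane)"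
        using W(1,3) w continuous_on_eq_continuous_at by (blast intro: isCont_def[THEN iffD1] tendsto_within_subset)
      moreover have "\<forall>\<^sub>F z in at w within upper_half_plane. \<psi> z = g_upper (int k) z"
        using eventually_at_in_open'[OF W(1) w(1)] W(4)
        unfolding eventually_at by (auto simp: upper_half_plane_def)
      ultimately have "(g_upper (int k) \<longlongrightarrow> \<psi> w) (at w within upper_half_plane)"
        using Lim_transform_eventually by blast
      then show ?thesis using False u upper_half_plane_limit by (simp add: f_def tendsto_Lim)
    qed (use W w in \<open>simp add: f_def\<close>)
    then show ?thesis using W t z(2) by (intro exI[of _ W] exI[of _ \<psi>]) auto
  qed
  have f_real: "Im (f z) = 0" if "z \<in> S" "Im z = 0" for z
    using f_local[OF that] that by fastforce
  have "closed (complex_of_real ` I_cut k)"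
    unfolding I_cut_def by (intro compact_imp_closed compact_continuous_image continuous_intros) auto
  then have "open S" by (simp add: S_def open_Compl)
  have holf: "f holomorphic_on upper_half_plane"
    by (rule holomorphic_transform[OF holomorphic_g_upper]) (simp add: f_def upper_half_plane_def)
  have "h holomorphic_on S"
    unfolding h_def
  proof (rule Schwarz_reflection[OF \<open>open S\<close>])
    show "cnj ` S \<subseteq> S" by (auto simp: S_def) (metis complex_cnj_cnj complex_cnj_complex_of_real imageI)
    show "f holomorphic_on S \<inter> {z. 0 < Im z}"
      by (rule holomorphic_on_subset[OF holf]) (auto simp: upper_half_plane_def)
    show "continuous_on (S \<inter> {z. 0 \<le> Im z}) f"
      unfolding continuous_on_eq_continuous_within
    proof
      fix z assume z: "z \<in> S \<inter> {z. 0 \<le> Im z}"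
      show "continuous (at z within S \<inter> {z. 0 \<le> Im z}) f"
      proof (cases "Im z > 0")
        case True
        then have "isCont f z"
          using holomorphic_on_imp_continuous_on[OF holf] open_upper_half_plane
          by (auto simp: continuous_on_eq_continuous_at upper_half_plane_def)
        then show ?thesis by (rule continuous_at_imp_continuous_at_within)
      next
        case False
        with z obtain W \<psi> where W: "open W" "z \<in> W" "continuous_on W \<psi>"
           "\<And>z. z \<in> W \<Longrightarrow> Im z \<ge> 0 \<Longrightarrow> f z = \<psi> z"
          using f_local[of z] by auto
        have "isCont \<psi> z" using W continuous_on_eq_continuous_at by blast
        then have "continuous (at z within S \<inter> {z. 0 \<le> Im z}) \<psi>"
          by (rule continuous_at_imp_continuous_at_within)
        moreover obtain d where d: "d > 0" "ball z d \<subseteq> W" using W openE by blast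
        moreover have "\<psi> w = f w" if "w \<in> S \<inter> {z. 0 \<le> Im z}" "dist w z < d" for w
        proof -
          have "w \<in> W" using d that by (auto simp: dist_commute)
          with W(4) that show ?thesis by simp
        qed
        ultimately show ?thesis
          using continuous_transform_within[of z _ \<psi> d f] z by blast
      qed
    qed
    show "f z \<in> \<real>" if "z \<in> S" "z \<in> \<real>" for z
      using f_real that by (simp add: complex_is_Real_iff)
  qed
  moreover have "h z = g_upper (int k) z" if "z \<in> upper_half_plane" for z
    using that by (simp add: h_def f_def upper_half_plane_def)
  moreover have "h (cnj z) = cnj (h z)" if "z \<in> S" for z
  proof (cases "Im z = 0")
    case True
    then have "cnj z = z" by (simp add: complex_eq_iff)
    moreover have "cnj (f z) = f z" using f_real[OF that True] by (simp add: complex_eq_iff)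
    ultimately show ?thesis using True by (simp add: h_def)
  qed (auto simp: h_def)
  ultimately show ?thesis unfolding is_g_extension_def S_def by blast
qed

lemma g_ext_is_extension:
  assumes "even k"
  shows "is_g_extension k (g_ext k)"
  unfolding g_ext_def using is_g_extension_exists[OF assms] by (rule someI_ex)

text \<open>The local inverse at the pole: s = -1/z tends to 0, where the inverse takes the value
  -k.\<close>

lemma g_upper_at_infinity:
  assumes k: "even k" and "e > 0"
  shows "\<exists>B>0. \<forall>z. Im z > 0 \<longrightarrow> norm z \<ge> B \<longrightarrow> norm (g_upper (int k) z + of_nat k) < e"
proof -
  obtain N \<phi> where N: "open N" "of_real (rGamma (- real k)) \<in> N" "\<phi> holomorphic_on N"
    "\<phi> (of_real (rGamma (- real k))) = of_real (- real k)"
    "\<And>s. s \<in> N \<Longrightarrow> Im s > 0 \<Longrightarrow> g_upper (int k) (- 1 / s) = \<phi> s"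
    by (rule g_upper_local_inverse[OF k Gamma_crit_around_pole]) metis
  have r0: "rGamma (- real k) = 0" by (simp add: rGamma_eq_zero_iff)
  have "isCont \<phi> 0"
    using holomorphic_on_imp_continuous_on[OF N(3)] N(1,2) r0 by (simp add: continuous_on_eq_continuous_at)
  then obtain d1 where d1: "d1 > 0" "\<And>s. dist s 0 < d1 \<Longrightarrow> dist (\<phi> s) (\<phi> 0) < e"
    using \<open>e > 0\<close> unfolding continuous_at_eps_delta by blast
  obtain d2 where d2: "d2 > 0" "ball 0 d2 \<subseteq> N" using openE[OF N(1)] N(2) r0 by (metis of_real_0)
  define d where "d = min d1 d2"
  have "norm (g_upper (int k) z + of_nat k) < e" if z: "Im z > 0" "norm z \<ge> 2 / d" for z
  proof -
    define s where "s = - 1 / z"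
    have "Im s > 0" using z by (simp add: s_def Im_divide sum_power2_gt_zero_iff)
    have "d > 0" using d1 d2 by (simp add: d_def)
    moreover have "norm z > 0" using z by auto
    ultimately have "norm s < d" using z(2) by (simp add: s_def norm_divide field_simps)
    then have "s \<in> N" "dist (\<phi> s) (\<phi> 0) < e" using d1 d2 by (auto simp: d_def)
    moreover have "g_upper (int k) z = \<phi> s" using N(5)[OF \<open>s \<in> N\<close> \<open>Im s > 0\<close>] by (simp add: s_def)
    ultimately show ?thesis using N(4) r0 by (simp add: dist_norm)
  qed
  moreover have "2 / d > 0" using d1 d2 by (simp add: d_def)
  ultimately show ?thesis by blast
qed

text \<open>For p = g_k(z) one has Gamma(p) = -z and Re p <= 2, so the decay of Gamma gives (Im p)^2
  |z| <= C once Im p >= 1; the summand 1 covers the other case.\<close>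

lemma Im_g_upper_bound:
  assumes k: "even k"
  shows "\<exists>C\<ge>0. \<forall>z. Im z > 0 \<longrightarrow> Im (g_upper (int k) z) \<le> 1 + C * norm z powr (- 1 / 2)"
proof -
  obtain C where C: "C > 0" "\<And>p::complex. Re p \<le> 2 \<Longrightarrow> 1 \<le> Im p \<Longrightarrow> (Im p)\<^sup>2 * norm (Gamma p) \<le> C"
    using norm_Gamma_decay by blast
  show ?thesis
  proof (intro exI[of _ "sqrt C"] conjI allI impI)
    fix z assume z: "Im z > 0"
    define p where "p = g_upper (int k) z"
    have z0: "z \<noteq> 0" using z by auto
    show "Im (g_upper (int k) z) \<le> 1 + sqrt C * norm z powr (- 1 / 2)"
    proof (cases "Im p \<ge> 1")
      case True
      have p: "Im p > 0" using g_upper_props(1)[OF z] by (simp add: p_def)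
      have "Re p \<le> 2"
        using Re_less_2_if_Im_ln_Gamma_neg[OF p] Im_ln_Gamma_g_upper_neg[OF z, of k] by (simp add: p_def)
      then have "(Im p)\<^sup>2 * norm (Gamma p) \<le> C" using True by (rule C)
      moreover have "Gamma p = - z"
        using exp_ln_Gamma_upper[OF p] g_upper_props(2)[OF z, of k] exp_minus_odd_pi[OF k z0]
        unfolding p_def by metis
      ultimately have "(Im p)\<^sup>2 \<le> C / norm z" using z0 by (simp add: pos_le_divide_eq)
      then have "Im p \<le> sqrt (C / norm z)" by (rule real_le_rsqrt)
      also have "\<dots> = sqrt C * norm z powr (- 1 / 2)"
        using z0 by (simp add: real_sqrt_divide powr_minus_divide powr_half_sqrt)
      finally show ?thesis by (simp add: p_def)
    next
      case False
      then show ?thesis using C(1) by (simp add: p_def add_increasing2)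
    qed
  qed (use C in auto)
qed

text \<open>The boundary value of Ln z - i (k+1) pi lies on the lower edge of the strip for t > 0
  and on the upper edge for t < 0. Inside I_k its real part ln |t| stays below the slit tip, so it
  belongs to the image, where the inverse is continuous.\<close>

lemma g_upper_boundary_limit:
  assumes k: "even k" and t: "- Gamma (Gamma_crit k) < t" "t < - Gamma (Gamma_crit (Suc k))" "t \<noteq> 0"
  shows "\<exists>L. ((\<lambda>y. g_upper (int k) (of_real t + \<i> * of_real y)) \<longlongrightarrow> L) (at_right 0)"
proof -
  define W where "W y = Ln (of_real t + \<i> * of_real y) - \<i> * (of_int (int k) + 1) * of_real pi" for y :: real
  define w where "w = (if t > 0 then of_real (ln t) - \<i> * (of_nat k + 1) * of_real pi
      else of_real (ln (- t)) - \<i> * of_nat k * of_real pi)"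
  have lim0: "((\<lambda>y. complex_of_real t + \<i> * of_real y) \<longlongrightarrow> of_real t) (at_right 0)"
    by (auto intro!: tendsto_eq_intros)
  have W: "(W \<longlongrightarrow> w) (at_right 0)"
  proof (cases "t > 0")
    case True
    then have "((\<lambda>y. Ln (of_real t + \<i> * of_real y)) \<longlongrightarrow> Ln (of_real t)) (at_right 0)"
      by (intro tendsto_Ln lim0) (auto simp: complex_nonpos_Reals_iff)
    then have "(W \<longlongrightarrow> Ln (of_real t) - \<i> * (of_int (int k) + 1) * of_real pi) (at_right 0)"
      unfolding W_def by (rule tendsto_diff[OF _ tendsto_const])
    then show ?thesis using True by (simp add: w_def Ln_of_real)
  next
    case False
    then have "t < 0" using t by simp
    \<comment> \<open>\<open>Ln\<close> jumps across the negative axis, so the limit is taken for Ln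
      (-z) and pi i is added for the approach from above.\<close>
    have "((\<lambda>y. Ln (- (of_real t + \<i> * of_real y))) \<longlongrightarrow> Ln (- of_real t)) (at_right 0)"
      by (intro tendsto_Ln tendsto_minus lim0) (use \<open>t < 0\<close> in \<open>auto simp: complex_nonpos_Reals_iff\<close>)
    moreover have "Ln (- complex_of_real t) = of_real (ln (- t))"
      using Ln_of_real[of "- t"] \<open>t < 0\<close> by simp
    ultimately have A: "((\<lambda>y. Ln (- (of_real t + \<i> * of_real y)) + \<i> * of_real pi
        - \<i> * (of_int (int k) + 1) * of_real pi) \<longlongrightarrow>
        of_real (ln (- t)) + \<i> * of_real pi - \<i> * (of_int (int k) + 1) * of_real pi) (at_right 0)"
      by (intro tendsto_intros) simp
    have B: "of_real (ln (- t)) + \<i> * of_real pi - \<i> * (of_int (int k) + 1) * of_real pi = w"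
      using False by (simp add: w_def algebra_simps)
    have C: "\<forall>\<^sub>F y in at_right 0. Ln (- (of_real t + \<i> * of_real y)) + \<i> * of_real pi
        - \<i> * (of_int (int k) + 1) * of_real pi = W y"
      using eventually_at_right_less[of 0]
    proof eventually_elim
      case (elim y)
      let ?z = "of_real t + \<i> * of_real y"
      have "Ln (- ?z) = Ln ?z - \<i> * of_real pi"
        using elim by (subst Ln_minus) (auto simp: complex_eq_iff)
      then show ?case by (simp add: W_def)
    qed
    show ?thesis by (rule Lim_transform_eventually[OF A[unfolded B] C])
  qed
  have "w \<in> ln_Gamma ` upper_half_plane"
  proof (rule ln_Gamma_limit_in_image)
    let ?y = "\<lambda>n. 1 / real (Suc n)"
    have up: "Im (complex_of_real t + \<i> * of_real (?y n)) > 0" for n by simp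
    show "Im (g_upper (int k) (of_real t + \<i> * of_real (?y n))) > 0" for n
      by (rule g_upper_props(1)[OF up])
    show "Im (ln_Gamma (g_upper (int k) (of_real t + \<i> * of_real (?y n)))) < 0" for n
      by (rule Im_ln_Gamma_g_upper_neg[OF up])
    have "filterlim ?y (at_right 0) sequentially"
      unfolding filterlim_at using LIMSEQ_Suc[OF lim_1_over_n] by auto
    from filterlim_compose[OF W this]
    have "(\<lambda>n. W (?y n)) \<longlonglongrightarrow> w" .
    moreover have "ln_Gamma (g_upper (int k) (of_real t + \<i> * of_real (?y n))) = W (?y n)" for n
      unfolding W_def by (rule g_upper_props(2)[OF up])
    ultimately show "(\<lambda>n. ln_Gamma (g_upper (int k) (of_real t + \<i> * of_real (?y n)))) \<longlonglongrightarrow> w" by presburger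
  next
    fix j assume j: "Im w = - real j * pi"
    show "Re w < ln \<bar>Gamma (Gamma_crit j)\<bar>"
    \<comment> \<open>The edge forces j = k + 1 for t > 0 and j = k for t < 0; then |t| <
      |Gamma(x_j)| because t is inside I_k.\<close>
    proof (cases "t > 0")
      case True
      then have "- (real k + 1) * pi = - real j * pi" using j by (simp add: w_def)
      then have "real j = real (Suc k)" by (simp only: mult_cancel_right) simp
      then have "j = Suc k" by (simp only: of_nat_eq_iff)
      then show ?thesis using True t Gamma_crit_sign[OF k] by (simp add: w_def)
    next
      case False
      then have "real k * pi = real j * pi" using j by (simp add: w_def)
      then have "j = k" by simp
      then show ?thesis using False t Gamma_crit_sign[OF k] by (simp add: w_def)
    qed
  qed
  then have "isCont inv_ln_Gamma w"
    using holomorphic_on_imp_continuous_on[OF holomorphic_inv_ln_Gamma] open_ln_Gamma_image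
    by (auto simp: continuous_on_eq_continuous_at)
  from isCont_tendsto_compose[OF this W] show ?thesis
    unfolding g_upper_def W_def by blast
qed

section \<open>The Stieltjes representation\<close>

text \<open>The three sides off the real axis have total length 4R and lie where the modulus is at
  least R.\<close>

lemma rectangle_base_integral_estimate:
  fixes f :: "complex \<Rightarrow> complex"
  assumes I: "(f has_contour_integral I) (rectpath (of_real (- R)) (Complex R R))"
    and cont: "continuous_on (path_image (rectpath (of_real (- R)) (Complex R R))) f"
    and bound: "\<And>\<zeta>. 0 \<le> Im \<zeta> \<Longrightarrow> R \<le> norm \<zeta> \<Longrightarrow> norm (f \<zeta>) \<le> B"
    and R: "0 < R"
  shows "norm (I - integral {- R..R} (\<lambda>t. f (of_real t))) \<le> 4 * R * B"
proof -
  let ?a1 = "complex_of_real (- R)" and ?a2 = "complex_of_real R"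
    and ?a3 = "Complex R R" and ?a4 = "Complex (- R) R"
  let ?\<gamma> = "rectpath ?a1 ?a3"
  have \<gamma>: "?\<gamma> = linepath ?a1 ?a2 +++ linepath ?a2 ?a3 +++ linepath ?a3 ?a4 +++ linepath ?a4 ?a1"
    by (simp add: rectpath_def Let_def complex_of_real_def)
  have segs: "closed_segment ?a1 ?a2 \<subseteq> path_image ?\<gamma>" "closed_segment ?a2 ?a3 \<subseteq> path_image ?\<gamma>"
    "closed_segment ?a3 ?a4 \<subseteq> path_image ?\<gamma>" "closed_segment ?a4 ?a1 \<subseteq> path_image ?\<gamma>"
    unfolding \<gamma> by (auto simp: path_image_join)
  have ci: "f contour_integrable_on linepath ?a1 ?a2" "f contour_integrable_on linepath ?a2 ?a3"
    "f contour_integrable_on linepath ?a3 ?a4" "f contour_integrable_on linepath ?a4 ?a1"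
    by (intro contour_integrable_continuous_linepath continuous_on_subset[OF cont] segs)+
  have "contour_integral ?\<gamma> f = contour_integral (linepath ?a1 ?a2) f
      + (contour_integral (linepath ?a2 ?a3) f + (contour_integral (linepath ?a3 ?a4) f
      + contour_integral (linepath ?a4 ?a1) f))"
    unfolding \<gamma> using ci by (simp add: contour_integrable_joinI)
  then have eq: "I - integral {- R..R} (\<lambda>t. f (of_real t))
     = contour_integral (linepath ?a2 ?a3) f + contour_integral (linepath ?a3 ?a4) f
      + contour_integral (linepath ?a4 ?a1) f"
    using contour_integral_unique[OF I] contour_integral_linepath_Reals_eq[of ?a1 ?a2 f] R by (auto simp: algebra_simps)
  have B: "0 \<le> B" using order_trans[OF norm_ge_zero bound[of "of_real R"]] R by simp
  have seg_R: "0 \<le> Im x \<and> R \<le> norm x"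
    if x: "x \<in> closed_segment u v" and uv: "(u, v) \<in> {(?a2, ?a3), (?a3, ?a4), (?a4, ?a1)}" for u v x
  proof -
    obtain s where s: "x = (1 - s) *\<^sub>R u + s *\<^sub>R v" "0 \<le> s" "s \<le> 1"
      using x unfolding closed_segment_def by blast
    have re: "Re x = Re u + s * (Re v - Re u)" and im: "Im x = (1 - s) * Im u + s * Im v"
      by (simp_all add: s(1) algebra_simps)
    have "0 \<le> Im u" "0 \<le> Im v" using uv R by auto
    then have "0 \<le> Im x" unfolding im using s(2,3) by simp
    moreover have "\<bar>Re x\<bar> = R \<or> \<bar>Im x\<bar> = R"
      using uv
    proof (elim insertE emptyE)
      assume "(u, v) = (?a3, ?a4)"
      then have "Im x = R" unfolding im by (simp add: algebra_simps)
      then show ?thesis using R by simp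
    qed (use R in \<open>simp_all add: re\<close>)
    ultimately show ?thesis using abs_Re_le_cmod[of x] abs_Im_le_cmod[of x] by auto
  qed
  have side: "norm (contour_integral (linepath u v) f) \<le> B * norm (v - u)"
    if "f contour_integrable_on linepath u v" "(u, v) \<in> {(?a2, ?a3), (?a3, ?a4), (?a4, ?a1)}" for u v
    by (rule contour_integral_bound_linepath[OF that(1) B]) (use bound seg_R[OF _ that(2)] in blast)
  have n: "norm (?a3 - ?a2) = R" "norm (?a4 - ?a3) = 2 * R" "norm (?a1 - ?a4) = R"
    using R by (auto simp: cmod_def real_sqrt_mult)
  have "norm (contour_integral (linepath ?a2 ?a3) f + contour_integral (linepath ?a3 ?a4) f
      + contour_integral (linepath ?a4 ?a1) f) \<le> B * R + B * (2 * R) + B * R"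
    using side[OF ci(2)] side[OF ci(3)] side[OF ci(4)] n by (intro norm_triangle_mono) simp_all
  then show ?thesis unfolding eq by (simp add: mult_ac)
qed

text \<open>Cauchy's formula at \<open>z\<close> and the conjugate of Cauchy's theorem at the reflected point
  \<open>cnj z\<close> combine to a formula that involves only the imaginary part on the real line.\<close>

lemma half_plane_Im_kernel_estimate:
  fixes G :: "complex \<Rightarrow> complex"
  assumes holo: "G holomorphic_on S" and S: "convex S" "open S" "{\<zeta>. 0 \<le> Im \<zeta>} \<subseteq> S"
    and bound: "\<And>\<zeta>. 0 \<le> Im \<zeta> \<Longrightarrow> R \<le> norm \<zeta> \<Longrightarrow> norm (G \<zeta>) \<le> M"
    and z: "0 < Im z" and R: "0 < R" "2 * norm z \<le> R"
  shows "norm (2 * of_real pi * \<i> * G z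
    - 2 * \<i> * integral {- R..R} (\<lambda>t. of_real (Im (G (of_real t))) / (of_real t - z))) \<le> 16 * M"
proof -
  let ?\<gamma> = "rectpath (of_real (- R)) (Complex R R)"
  have box: "z \<in> box (of_real (- R)) (Complex R R)"
    using z R abs_Re_le_cmod[of z] abs_Im_le_cmod[of z] by (auto simp: in_box_complex_iff abs_le_iff)
  have img: "path_image ?\<gamma> \<subseteq> {\<zeta>. 0 \<le> Im \<zeta>} - {z}"
  proof -
    have "path_image ?\<gamma> = cbox (of_real (- R)) (Complex R R) - box (of_real (- R)) (Complex R R)"
      using R by (intro path_image_rectpath_cbox_minus_box) simp_all
    moreover have "cbox (of_real (- R)) (Complex R R) \<subseteq> {\<zeta>. 0 \<le> Im \<zeta>}"
      by (auto simp: in_cbox_complex_iff)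
    ultimately show ?thesis using box by blast
  qed
  have M: "0 \<le> M" using order_trans[OF norm_ge_zero bound[of "of_real R"]] R by simp
  have contG: "continuous_on A G" if "A \<subseteq> {\<zeta>. 0 \<le> Im \<zeta>}" for A
    using holomorphic_on_imp_continuous_on[OF holo] S(3) that by (blast intro: continuous_on_subset)
  have kernel: "norm (I - integral {- R..R} (\<lambda>t. G (of_real t) / (of_real t - u))) \<le> 8 * M"
    if I: "((\<lambda>w. G w / (w - u)) has_contour_integral I) ?\<gamma>"
      and u: "u \<notin> path_image ?\<gamma>" "norm u = norm z" for I u
  proof -
    \<comment> \<open>As |u| = |z| <= R/2, denominators on the far sides are at least R/2, and 4R
      times M/(R/2) is 8M.\<close>
    have "norm (I - integral {- R..R} (\<lambda>t. G (of_real t) / (of_real t - u))) \<le> 4 * R * (M / (R / 2))"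
    proof (rule rectangle_base_integral_estimate[OF I])
      show "continuous_on (path_image ?\<gamma>) (\<lambda>w. G w / (w - u))"
        using img u by (intro continuous_intros contG) auto
      fix x :: complex assume x: "0 \<le> Im x" "R \<le> norm x"
      have "R / 2 \<le> norm (x - u)" using norm_triangle_ineq2[of x u] x R u by linarith
      then show "norm (G x / (x - u)) \<le> M / (R / 2)"
        unfolding norm_divide using bound[OF x] R M by (intro frac_le) auto
    qed (rule R)
    also have "\<dots> = 8 * M" using R by (simp add: field_simps)
    finally show ?thesis .
  qed
  have 1: "norm (2 * of_real pi * \<i> * G z
      - integral {- R..R} (\<lambda>t. G (of_real t) / (of_real t - z))) \<le> 8 * M"
  proof (rule kernel)
    have "((\<lambda>w. G w / (w - z)) has_contour_integral (2 * of_real pi * \<i> * winding_number ?\<gamma> z * G z)) ?\<gamma>"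
    proof -
      have "z \<in> interior S" using z S by (auto simp: interior_open)
      moreover have "path_image ?\<gamma> \<subseteq> S - {z}" using img S(3) by blast
      ultimately show ?thesis
        using Cauchy_integral_formula_convex_simple[OF S(1) holo, of z ?\<gamma>] by simp
    qed
    then show "((\<lambda>w. G w / (w - z)) has_contour_integral (2 * of_real pi * \<i> * G z)) ?\<gamma>"
      by (simp only: winding_number_rectpath[OF box] mult_1_right)
  qed (use img in auto)
  define J where "J = integral {- R..R} (\<lambda>t. G (of_real t) / (of_real t - cnj z))"
  have "norm (0 - J) \<le> 8 * M"
    unfolding J_def
  proof (rule kernel)
    show "((\<lambda>w. G w / (w - cnj z)) has_contour_integral 0) ?\<gamma>"
    \<comment> \<open>The pole \<open>cnj z\<close> lies below the axis and outside the half plane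
      Im w > -Im z.\<close>
    proof (rule Cauchy_theorem_convex_simple)
      show "(\<lambda>w. G w / (w - cnj z)) holomorphic_on (S \<inter> {w. Im w > - Im z})"
        by (intro holomorphic_intros holomorphic_on_subset[OF holo]) auto
      show "convex (S \<inter> {w. Im w > - Im z})"
        using S(1) by (intro convex_Int convex_halfspace_Im_gt)
      show "path_image ?\<gamma> \<subseteq> S \<inter> {w. Im w > - Im z}"
        using img S(3) z by force
    qed auto
  qed (use img z in auto)
  then have 2: "norm (cnj J) \<le> 8 * M" by simp
  have nz: "of_real t - z \<noteq> 0" for t using z by (auto simp: complex_eq_iff)
  have contGr: "continuous_on {- R..R} (\<lambda>t. G (of_real t))"
    by (rule continuous_on_compose2[OF contG[of "{\<zeta>. 0 \<le> Im \<zeta>}"]]) (auto intro!: continuous_intros)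
  have int: "(\<lambda>t. G (of_real t) / (of_real t - z)) integrable_on {- R..R}"
    "(\<lambda>t. cnj (G (of_real t)) / (of_real t - z)) integrable_on {- R..R}"
    using nz by (intro integrable_continuous_interval continuous_intros contGr; simp)+
  have cJ: "cnj J = integral {- R..R} (\<lambda>t. cnj (G (of_real t)) / (of_real t - z))"
    unfolding J_def integral_cnj by simp
  have "2 * of_real pi * \<i> * G z
    - 2 * \<i> * integral {- R..R} (\<lambda>t. of_real (Im (G (of_real t))) / (of_real t - z))
    = (2 * of_real pi * \<i> * G z - integral {- R..R} (\<lambda>t. G (of_real t) / (of_real t - z))) + cnj J"
  proof -
    have "2 * \<i> * integral {- R..R} (\<lambda>t. of_real (Im (G (of_real t))) / (of_real t - z))
      = integral {- R..R} (\<lambda>t. 2 * \<i> * (of_real (Im (G (of_real t))) / (of_real t - z)))"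
      by (rule integral_mult_right[symmetric])
    also have "\<dots> = integral {- R..R} (\<lambda>t. G (of_real t) / (of_real t - z) - cnj (G (of_real t)) / (of_real t - z))"
    proof (rule integral_cong)
      fix t
      have "2 * \<i> * of_real (Im (G (of_real t))) = G (of_real t) - cnj (G (of_real t))"
        by (simp add: complex_diff_cnj)
      then show "2 * \<i> * (of_real (Im (G (of_real t))) / (of_real t - z))
        = G (of_real t) / (of_real t - z) - cnj (G (of_real t)) / (of_real t - z)"
        by (simp flip: diff_divide_distrib)
    qed
    also have "\<dots> = integral {- R..R} (\<lambda>t. G (of_real t) / (of_real t - z)) - cnj J"
      unfolding cJ by (rule integral_diff[OF int])
    finally show ?thesis by simp
  qed
  moreover have "8 * M + 8 * M = 16 * M" by simp
  ultimately show ?thesis using norm_triangle_mono[OF 1 2] by presburger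
qed

text \<open>Reflecting the known one-sided integrand gives the even function, also at the origin,
  where 0 \<open>powr\<close> a is 0.\<close>

lemma set_integrable_abs_powr_minus_half:
  "set_integrable lborel {- R..R} (\<lambda>t. \<bar>t\<bar> powr (- 1 / 2) :: real)"
proof (cases "R \<ge> 0")
  case True
  define f where "f t = indicator {0..R} t *\<^sub>R (t powr (- 1 / 2))" for t :: real
  have "(\<lambda>t. t powr (- 1 / 2)) integrable_on {0..R}"
    using has_integral_powr_from_0[of "- 1 / 2" R] True by (auto simp: integrable_on_def)
  then have "set_integrable lebesgue {0..R} (\<lambda>t. t powr (- 1 / 2))"
    by (subst absolutely_integrable_on_iff_nonneg) auto
  then have "integrable lborel f"
    unfolding set_integrable_def f_def by (subst (asm) integrable_completion) auto
  then have "integrable lborel (\<lambda>t. f t + f (- t))"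
    using lborel_integrable_real_affine[of f "-1" 0] by (intro Bochner_Integration.integrable_add) auto
  then show ?thesis
    unfolding set_integrable_def
    by (rule Bochner_Integration.integrable_bound) (auto simp: f_def indicator_def abs_if)
qed (simp add: set_integrable_def)

text \<open>The kernel estimate is applied to shifted copies of g - c for a fixed large R. The shift
  tends to 0 by dominated convergence, and afterwards the bound e on g - c outside radius R is made
  arbitrarily small.\<close>

lemma upper_half_plane_Stieltjes:
  fixes g :: "complex \<Rightarrow> complex" and c :: real and d w :: "real \<Rightarrow> real"
  assumes holo: "g holomorphic_on upper_half_plane"
    and inf: "\<And>e. e > 0 \<Longrightarrow> \<exists>B>0. \<forall>z. Im z > 0 \<longrightarrow> norm z \<ge> B \<longrightarrow> norm (g z - of_real c) < e"
    and bound: "AE t in lborel. \<forall>y>0. \<bar>Im (g (of_real t + \<i> * of_real y))\<bar> \<le> w t"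
    and w: "\<And>R. set_integrable lborel {- R..R} w"
    and bdry: "AE t in lborel. (\<lambda>n. Im (g (of_real t + \<i> * of_real (1 / real (Suc n))))) \<longlonglongrightarrow> pi * d t"
    and d: "d \<in> borel_measurable borel" "\<And>t. t \<notin> {a..b} \<Longrightarrow> d t = 0"
    and z: "Im z > 0"
  shows "g z = of_real c + (LINT t : {a..b} | lborel. of_real (d t) / (of_real t - z))"
proof -
  define J where "J = (LINT t : {a..b} | lborel. of_real (d t) / (of_real t - z))"
  define y where "y n = 1 / real (Suc n)" for n
  have y_pos: "y n > 0" for n by (simp add: y_def)
  have y0: "y \<longlonglongrightarrow> 0" unfolding y_def by (rule LIMSEQ_Suc[OF lim_1_over_n])
  define h where "h n t = Im (g (of_real t + \<i> * of_real (y n)))" for n t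
  have nz: "of_real t - z \<noteq> 0" for t using z by (auto simp: complex_eq_iff)
  have nz_le: "Im z \<le> norm (of_real t - z)" for t
    using abs_Im_le_cmod[of "of_real t - z"] by simp
  have cont_h: "continuous_on UNIV (h n)" for n
    unfolding h_def
    by (intro continuous_intros continuous_on_compose2[OF holomorphic_on_imp_continuous_on[OF holo]])
      (use y_pos in \<open>auto simp: upper_half_plane_def\<close>)
  \<comment> \<open>The constant is real, so F and g have the same imaginary part.\<close>
  define F where "F z = g z - of_real c" for z
  have est: "norm (2 * of_real pi * \<i> * (F z - J)) \<le> 16 * e" if e: "e > 0" for e
  proof -
    obtain B where B: "B > 0" "\<And>\<zeta>. Im \<zeta> > 0 \<Longrightarrow> norm \<zeta> \<ge> B \<Longrightarrow> norm (F \<zeta>) < e"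
      using inf[OF e] unfolding F_def by blast
    \<comment> \<open>Large enough for |F| < e outside radius R, for the kernel estimate, and for
      [a, b] to lie in [-R, R]; the limit integral is then pi J for every e.\<close>
    define R where "R = max (max B (2 * norm z)) (max \<bar>a\<bar> \<bar>b\<bar>)"
    have R: "0 < R" "B \<le> R" "2 * norm z \<le> R" "\<bar>a\<bar> \<le> R" "\<bar>b\<bar> \<le> R" using B(1) by (auto simp: R_def)
    define s where "s n t = indicator {- R..R} t *\<^sub>R (of_real (h n t) / (of_real t - z))" for n t
    define f where "f t = indicator {- R..R} t *\<^sub>R (of_real (pi * d t) / (of_real t - z))" for t
    have int_s: "set_integrable lborel {- R..R} (\<lambda>t. of_real (h n t) / (of_real t - z))" for n
      unfolding set_integrable_def
      by (intro borel_integrable_compact compact_Icc continuous_intros continuous_on_subset[OF cont_h] nz ballI) auto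
    have "(\<lambda>n. integral\<^sup>L lborel (s n)) \<longlonglongrightarrow> integral\<^sup>L lborel f"
    proof (rule integral_dominated_convergence)
      show "f \<in> borel_measurable lborel" unfolding f_def using d(1) by measurable
      show "s n \<in> borel_measurable lborel" for n
        using int_s[of n] unfolding set_integrable_def s_def by (rule borel_measurable_integrable)
      show "integrable lborel (\<lambda>t. indicator {- R..R} t *\<^sub>R w t / Im z)"
        using w[of R] unfolding set_integrable_def by simp
      show "AE t in lborel. (\<lambda>n. s n t) \<longlonglongrightarrow> f t"
        using bdry unfolding s_def f_def h_def y_def
        by eventually_elim (intro tendsto_intros nz)
      show "AE t in lborel. norm (s n t) \<le> indicator {- R..R} t *\<^sub>R w t / Im z" for n
        using bound
      proof eventually_elim
        case (elim t)
        then have "\<bar>h n t\<bar> \<le> w t" using y_pos[of n] by (simp add: h_def)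
        then have "\<bar>h n t\<bar> / norm (of_real t - z) \<le> w t / Im z"
          using nz_le[of t] z by (intro frac_le) auto
        then show "norm (s n t) \<le> indicator {- R..R} t *\<^sub>R w t / Im z"
          by (auto simp: s_def indicator_def norm_divide)
      qed
    qed
    moreover have "integral\<^sup>L lborel f = of_real pi * J"
    proof -
      have "f = (\<lambda>t. of_real pi * (indicator {a..b} t *\<^sub>R (of_real (d t) / (of_real t - z))))"
      proof
        fix t
        show "f t = of_real pi * (indicator {a..b} t *\<^sub>R (of_real (d t) / (of_real t - z)))"
          using d(2)[of t] R by (cases "t \<in> {a..b}") (auto simp: f_def indicator_def)
      qed
      then show ?thesis by (simp only: J_def set_lebesgue_integral_def integral_mult_right_zero)
    qed
    moreover have "integral\<^sup>L lborel (s n) = integral {- R..R} (\<lambda>t. of_real (h n t) / (of_real t - z))" for n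
      using set_borel_integral_eq_integral(2)[OF int_s[of n]]
      unfolding s_def set_lebesgue_integral_def .
    ultimately have lim_int: "(\<lambda>n. integral {- R..R} (\<lambda>t. of_real (h n t) / (of_real t - z))) \<longlonglongrightarrow> of_real pi * J"
      by simp
    have "isCont F z"
      using holomorphic_on_imp_continuous_on[OF holo] open_upper_half_plane z
      unfolding F_def by (auto intro!: continuous_intros simp: continuous_on_eq_continuous_at upper_half_plane_def)
    moreover have "(\<lambda>n. z + \<i> * of_real (y n)) \<longlonglongrightarrow> z"
      using y0 by (auto intro!: tendsto_eq_intros)
    ultimately have lim_F: "(\<lambda>n. F (z + \<i> * of_real (y n))) \<longlonglongrightarrow> F z"
      by (rule isCont_tendsto_compose)
    have le: "norm (2 * of_real pi * \<i> * F (z + \<i> * of_real (y n))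
       - 2 * \<i> * integral {- R..R} (\<lambda>t. of_real (h n t) / (of_real t - z))) \<le> 16 * e" for n
    proof -
      define G where "G \<zeta> = F (\<zeta> + \<i> * of_real (y n))" for \<zeta>
      have "norm (2 * of_real pi * \<i> * G z
        - 2 * \<i> * integral {- R..R} (\<lambda>t. of_real (Im (G (of_real t))) / (of_real t - z))) \<le> 16 * e"
      proof (rule half_plane_Im_kernel_estimate)
        show "G holomorphic_on {\<zeta>. Im \<zeta> > - y n}"
          unfolding G_def F_def
          by (intro holomorphic_intros holomorphic_on_compose_gen[OF _ holo, unfolded o_def])
            (auto simp: upper_half_plane_def)
        show "norm (G \<zeta>) \<le> e" if \<zeta>: "0 \<le> Im \<zeta>" "R \<le> norm \<zeta>" for \<zeta>
        proof -
          \<comment> \<open>Raising a point of the closed half plane increases its modulus, so the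
            bound outside R survives the shift.\<close>
          have "norm \<zeta> \<le> norm (\<zeta> + \<i> * of_real (y n))"
            unfolding cmod_def using \<zeta>(1) y_pos[of n]
            by (intro real_sqrt_le_mono add_mono) (auto intro: power_mono)
          then show ?thesis unfolding G_def using \<zeta> R y_pos[of n] by (intro less_imp_le[OF B(2)]) auto
        qed
      qed (use z R y_pos[of n] in \<open>auto intro: convex_halfspace_Im_gt open_halfspace_Im_gt\<close>)
      then show ?thesis by (simp add: G_def F_def h_def)
    qed
    have "(\<lambda>n. norm (2 * of_real pi * \<i> * F (z + \<i> * of_real (y n))
       - 2 * \<i> * integral {- R..R} (\<lambda>t. of_real (h n t) / (of_real t - z))))
       \<longlonglongrightarrow> norm (2 * of_real pi * \<i> * F z - 2 * \<i> * (of_real pi * J))"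
      by (intro tendsto_norm tendsto_diff tendsto_mult tendsto_const lim_F lim_int)
    then have "norm (2 * of_real pi * \<i> * F z - 2 * \<i> * (of_real pi * J)) \<le> 16 * e"
      by (rule LIMSEQ_le_const2) (use le in blast)
    then show ?thesis by (simp add: algebra_simps)
  qed
  have "norm (2 * of_real pi * \<i> * (F z - J)) \<le> 0"
  proof (rule field_le_epsilon)
    fix e :: real assume "e > 0"
    then show "norm (2 * of_real pi * \<i> * (F z - J)) \<le> 0 + e" using est[of "e / 16"] by simp
  qed
  then have "F z = J" by simp
  then show ?thesis by (simp add: F_def J_def diff_eq_eq add.commute)
qed

section \<open>The density d_k and the integral representation of g_k\<close>

lemma g_ext_upper:
  assumes "even k" "Im z > 0"
  shows "g_ext k z = g_upper (int k) z"
  using g_ext_is_extension[OF assms(1)] assms(2) by (simp add: is_g_extension_def upper_half_plane_def)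

lemma open_Compl_I_cut: "open (- complex_of_real ` I_cut k)"
  unfolding I_cut_def
  by (intro open_Compl compact_imp_closed compact_continuous_image continuous_intros compact_Icc)

lemma isCont_g_ext:
  assumes "even k" "z \<notin> complex_of_real ` I_cut k"
  shows "isCont (g_ext k) z"
  using g_ext_is_extension[OF assms(1)] assms(2) open_Compl_I_cut[of k]
  by (auto simp: is_g_extension_def continuous_on_eq_continuous_at dest!: holomorphic_on_imp_continuous_on)

text \<open>Off \<open>I\<^sub>k\<close> the boundary value vanishes because the extension is real on the real line.\<close>

lemma Im_g_upper_boundary:
  assumes k: "even k" and t: "t \<notin> {0, - Gamma (Gamma_crit k), - Gamma (Gamma_crit (Suc k))}"
  shows "(\<lambda>n. Im (g_upper (int k) (of_real t + \<i> * of_real (1 / real (Suc n)))))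
    \<longlonglongrightarrow> pi * (if t \<in> I_cut k then d_density k t else 0)"
proof -
  let ?G = "\<lambda>y. g_ext k (of_real t + \<i> * of_real y)"
  have ev: "\<forall>\<^sub>F y in at_right 0. g_upper (int k) (of_real t + \<i> * of_real y) = ?G y"
    using eventually_at_right_less[of "0::real"]
    by eventually_elim (simp add: g_ext_upper[OF k])
  have seq: "filterlim (\<lambda>n. 1 / real (Suc n)) (at_right 0) sequentially"
    unfolding filterlim_at using LIMSEQ_Suc[OF lim_1_over_n] by auto
  have "\<exists>L. (?G \<longlongrightarrow> L) (at_right 0) \<and> Im L = pi * (if t \<in> I_cut k then d_density k t else 0)"
  proof (cases "t \<in> I_cut k")
    case True
    then have "- Gamma (Gamma_crit k) < t" "t < - Gamma (Gamma_crit (Suc k))" "t \<noteq> 0"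
      using t by (auto simp: I_cut_def)
    from g_upper_boundary_limit[OF k this] obtain L where
      "((\<lambda>y. g_upper (int k) (of_real t + \<i> * of_real y)) \<longlongrightarrow> L) (at_right 0)" by blast
    then have L: "(?G \<longlongrightarrow> L) (at_right 0)" using ev by (rule Lim_transform_eventually)
    then have "Lim (at_right 0) ?G = L" by (intro tendsto_Lim) simp
    then show ?thesis using L True by (auto simp: d_density_def)
  next
    case False
    then have out: "of_real t \<notin> complex_of_real ` I_cut k" by auto
    have "((\<lambda>y. complex_of_real t + \<i> * of_real y) \<longlongrightarrow> of_real t) (at_right 0)"
      by (auto intro!: tendsto_eq_intros)
    then have "(?G \<longlongrightarrow> g_ext k (of_real t)) (at_right 0)"
      by (rule isCont_tendsto_compose[OF isCont_g_ext[OF k out]])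
    moreover have "g_ext k (cnj (of_real t)) = cnj (g_ext k (of_real t))"
      using g_ext_is_extension[OF k] out unfolding is_g_extension_def by blast
    then have "Im (g_ext k (of_real t)) = 0" by (metis Reals_cnj_iff complex_cnj_complex_of_real complex_is_Real_iff)
    ultimately show ?thesis using False by auto
  qed
  then obtain L where L: "(?G \<longlongrightarrow> L) (at_right 0)"
    "Im L = pi * (if t \<in> I_cut k then d_density k t else 0)" by blast
  have "(\<lambda>n. Im (?G (1 / real (Suc n)))) \<longlonglongrightarrow> Im L"
    by (intro tendsto_Im filterlim_compose[OF L(1) seq])
  moreover have "?G (1 / real (Suc n)) = g_upper (int k) (of_real t + \<i> * of_real (1 / real (Suc n)))" for n
    by (rule g_ext_upper[OF k]) simp
  ultimately show ?thesis using L(2) by simp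
qed

text \<open>A pointwise limit of continuous functions away from three exceptional points.\<close>

lemma d_density_measurable:
  assumes k: "even k"
  shows "(\<lambda>t. if t \<in> I_cut k then d_density k t else 0) \<in> borel_measurable borel"
proof -
  define X where "X = {0, - Gamma (Gamma_crit k), - Gamma (Gamma_crit (Suc k))}"
  define u where "u n t = Im (g_upper (int k) (of_real t + \<i> * of_real (1 / real (Suc n)))) / pi" for n :: nat and t :: real
  have "continuous_on UNIV (u n)" for n
    unfolding u_def
    by (intro continuous_intros continuous_on_compose2[OF holomorphic_on_imp_continuous_on[OF holomorphic_g_upper]])
      (auto simp: upper_half_plane_def)
  then have [measurable]: "u n \<in> borel_measurable borel" for n
    by (rule borel_measurable_continuous_onI)
  have [measurable]: "X \<in> sets borel" by (auto simp: X_def)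
  have "(\<lambda>t. if t \<in> X then 0 else if t \<in> I_cut k then d_density k t else 0) \<in> borel_measurable borel"
  proof (rule borel_measurable_LIMSEQ_real)
    show "(\<lambda>t. if t \<in> X then 0 else u n t) \<in> borel_measurable borel" for n by measurable
    fix t
    show "(\<lambda>n. if t \<in> X then 0 else u n t) \<longlonglongrightarrow> (if t \<in> X then 0 else if t \<in> I_cut k then d_density k t else 0)"
      using tendsto_divide[OF Im_g_upper_boundary[OF k, of t] tendsto_const[of pi]]
      by (auto simp: X_def u_def)
  qed
  then show ?thesis
    by (rule measurable_discrete_difference[where X = X]) (auto simp: X_def)
qed

lemma I_cut_dist_pos:
  assumes "z \<notin> complex_of_real ` I_cut k"
  obtains \<delta> where "\<delta> > 0" "\<And>t. t \<in> I_cut k \<Longrightarrow> \<delta> \<le> norm (of_real t - z)"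
proof -
  obtain \<delta> where "\<delta> > 0" "ball z \<delta> \<subseteq> - complex_of_real ` I_cut k"
    using openE[OF open_Compl_I_cut, of z k] assms by blast
  then show ?thesis
    by (intro that[of \<delta>]) (force simp: dist_norm norm_minus_commute)+
qed

lemma AE_not_in_countable: "countable X \<Longrightarrow> AE t in lborel. t \<notin> X"
  for X :: "real set"
  using countable_imp_null_set_lborel by (rule AE_not_in)

text \<open>Replacing |z| by |Re z| = |t| makes the majorant independent of the height y; the point
  t = 0 is discarded as a null set.\<close>

lemma abs_Im_g_upper_bound:
  assumes k: "even k"
  obtains C where "\<And>R. set_integrable lborel {- R..R} (\<lambda>t. 1 + C * \<bar>t\<bar> powr (- 1 / 2))"
    "AE t in lborel. \<forall>y>0. \<bar>Im (g_upper (int k) (of_real t + \<i> * of_real y))\<bar> \<le> 1 + C * \<bar>t\<bar> powr (- 1 / 2)"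
proof -
  obtain C where C: "C \<ge> 0" "\<And>z. Im z > 0 \<Longrightarrow> Im (g_upper (int k) z) \<le> 1 + C * norm z powr (- 1 / 2)"
    using Im_g_upper_bound[OF k] by blast
  show ?thesis
  proof (rule that[of C])
    have "set_integrable lborel {- R..R} (\<lambda>t. 1 :: real)" for R :: real
      by (intro borel_integrable_atLeastAtMost' continuous_intros)
    then show "set_integrable lborel {- R..R} (\<lambda>t. 1 + C * \<bar>t\<bar> powr (- 1 / 2))" for R
      by (intro set_integral_add set_integrable_mult_right set_integrable_abs_powr_minus_half)
    show "AE t in lborel. \<forall>y>0. \<bar>Im (g_upper (int k) (of_real t + \<i> * of_real y))\<bar> \<le> 1 + C * \<bar>t\<bar> powr (- 1 / 2)"
      using AE_lborel_singleton[of "0::real"]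
    proof (eventually_elim, intro allI impI)
      fix t y :: real assume t: "t \<noteq> 0" and y: "y > 0"
      define z where "z = of_real t + \<i> * of_real y"
      have z: "Im z > 0" "Re z = t" using y by (auto simp: z_def)
      have "norm z powr (- 1 / 2) \<le> \<bar>t\<bar> powr (- 1 / 2)"
        using abs_Re_le_cmod[of z] z t by (intro powr_mono2') auto
      then have "C * norm z powr (- 1 / 2) \<le> C * \<bar>t\<bar> powr (- 1 / 2)" using C(1) by (rule mult_left_mono)
      then show "\<bar>Im (g_upper (int k) (of_real t + \<i> * of_real y))\<bar> \<le> 1 + C * \<bar>t\<bar> powr (- 1 / 2)"
        using C(2)[OF z(1)] g_upper_props(1)[OF z(1), of k] unfolding z_def[symmetric] by linarith
    qed
  qed
qed

lemma AE_Im_g_upper_boundary: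
  assumes k: "even k"
  shows "AE t in lborel. (\<lambda>n. Im (g_upper (int k) (of_real t + \<i> * of_real (1 / real (Suc n)))))
    \<longlonglongrightarrow> pi * (if t \<in> I_cut k then d_density k t else 0)"
proof -
  have "AE t in lborel. t \<notin> {0, - Gamma (Gamma_crit k), - Gamma (Gamma_crit (Suc k))}"
    by (rule AE_not_in_countable) auto
  then show ?thesis by eventually_elim (rule Im_g_upper_boundary[OF k])
qed

text \<open>The majorant of Im g_k passes to the boundary limit pi d_k, and pi >= 1.\<close>

lemma d_density_integrable:
  assumes k: "even k"
  shows "set_integrable lborel (I_cut k) (d_density k)"
proof -
  obtain C where w: "\<And>R. set_integrable lborel {- R..R} (\<lambda>t. 1 + C * \<bar>t\<bar> powr (- 1 / 2))"
    and bound: "AE t in lborel. \<forall>y>0. \<bar>Im (g_upper (int k) (of_real t + \<i> * of_real y))\<bar> \<le> 1 + C * \<bar>t\<bar> powr (- 1 / 2)"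
    by (rule abs_Im_g_upper_bound[OF k]) (rule that)
  define R where "R = max (Gamma (Gamma_crit k)) (- Gamma (Gamma_crit (Suc k)))"
  have sub: "I_cut k \<subseteq> {- R..R}" by (auto simp: I_cut_def R_def)
  have ind: "indicator (I_cut k) t *\<^sub>R d_density k t = (if t \<in> I_cut k then d_density k t else 0)" for t
    by (simp add: indicator_def)
  have "integrable lborel (\<lambda>t. if t \<in> I_cut k then d_density k t else 0)"
  proof (rule Bochner_Integration.integrable_bound)
    show "integrable lborel (\<lambda>t. indicator {- R..R} t *\<^sub>R (1 + C * \<bar>t\<bar> powr (- 1 / 2)))"
      using w[of R] by (simp add: set_integrable_def)
    show "AE t in lborel. norm (if t \<in> I_cut k then d_density k t else 0)
      \<le> norm (indicator {- R..R} t *\<^sub>R (1 + C * \<bar>t\<bar> powr (- 1 / 2)))"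
      using bound AE_Im_g_upper_boundary[OF k]
    proof eventually_elim
      case (elim t)
      have "\<bar>pi * (if t \<in> I_cut k then d_density k t else 0)\<bar> \<le> 1 + C * \<bar>t\<bar> powr (- 1 / 2)"
        by (rule LIMSEQ_le_const2[OF tendsto_rabs[OF elim(2)]])
          (intro exI allI impI elim(1)[rule_format], simp)
      moreover have "\<bar>d_density k t\<bar> \<le> \<bar>pi * d_density k t\<bar>"
        using mult_right_mono[of 1 pi "\<bar>d_density k t\<bar>"] pi_ge_two by (simp add: abs_mult)
      ultimately show ?case using sub by (auto simp: indicator_def)
    qed
  qed (use d_density_measurable[OF k] in simp)
  then show ?thesis unfolding set_integrable_def ind .
qed

lemma d_density_kernel_integrable:
  assumes k: "even k" and z: "z \<notin> complex_of_real ` I_cut k"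
  shows "set_integrable lborel (I_cut k) (\<lambda>t. of_real (d_density k t) / (of_real t - z))"
proof -
  let ?d = "\<lambda>t. if t \<in> I_cut k then d_density k t else 0"
  obtain \<delta> where \<delta>: "\<delta> > 0" "\<And>t. t \<in> I_cut k \<Longrightarrow> \<delta> \<le> norm (of_real t - z)"
    using I_cut_dist_pos[OF z] by blast
  have [measurable]: "?d \<in> borel_measurable borel" by (rule d_density_measurable[OF k])
  have eq: "indicator (I_cut k) t *\<^sub>R (of_real (d_density k t) / (of_real t - z)) = of_real (?d t) / (of_real t - z)" for t
    by (simp add: indicator_def)
  have "integrable lborel (\<lambda>t. of_real (?d t) / (of_real t - z))"
  proof (rule Bochner_Integration.integrable_bound)
    show "integrable lborel (\<lambda>t. (indicator (I_cut k) t *\<^sub>R d_density k t) / \<delta>)"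
      using d_density_integrable[OF k] unfolding set_integrable_def by simp
    show "AE t in lborel. norm (of_real (?d t) / (of_real t - z)) \<le> norm ((indicator (I_cut k) t *\<^sub>R d_density k t) / \<delta>)"
    proof (rule AE_I2)
      fix t
      show "norm (of_real (?d t) / (of_real t - z)) \<le> norm ((indicator (I_cut k) t *\<^sub>R d_density k t) / \<delta>)"
        using \<delta>(1) \<delta>(2)[of t] by (auto simp: indicator_def norm_divide intro!: divide_left_mono mult_pos_pos)
    qed
  qed measurable
  then show ?thesis unfolding set_integrable_def eq .
qed

lemma I_cut_interval: "I_cut k = {- Gamma (Gamma_crit k)..- Gamma (Gamma_crit (Suc k))}"
  by (simp add: I_cut_def)

lemma g_ext_representation_upper:
  assumes k: "even k" and z: "Im z > 0"
  shows "g_ext k z = (LINT t : I_cut k | lborel. of_real (d_density k t) / (of_real t - z)) - of_nat k"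
proof -
  let ?d = "\<lambda>t. if t \<in> I_cut k then d_density k t else 0"
  obtain C where w: "\<And>R. set_integrable lborel {- R..R} (\<lambda>t. 1 + C * \<bar>t\<bar> powr (- 1 / 2))"
    and bound: "AE t in lborel. \<forall>y>0. \<bar>Im (g_upper (int k) (of_real t + \<i> * of_real y))\<bar> \<le> 1 + C * \<bar>t\<bar> powr (- 1 / 2)"
    by (rule abs_Im_g_upper_bound[OF k]) (rule that)
  have "g_upper (int k) z = of_real (- real k) + (LINT t : {- Gamma (Gamma_crit k)..- Gamma (Gamma_crit (Suc k))}
      | lborel. of_real (?d t) / (of_real t - z))"
  proof (rule upper_half_plane_Stieltjes[where d = ?d, OF holomorphic_g_upper _ bound w _ _ _ z])
    show "\<exists>B>0. \<forall>z. Im z > 0 \<longrightarrow> norm z \<ge> B \<longrightarrow> norm (g_upper (int k) z - of_real (- real k)) < e" if "e > 0" for e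
      using g_upper_at_infinity[OF k that] by simp
  qed (use AE_Im_g_upper_boundary[OF k] d_density_measurable[OF k] in \<open>auto simp: I_cut_interval\<close>)
  also have "(LINT t : {- Gamma (Gamma_crit k)..- Gamma (Gamma_crit (Suc k))} | lborel. of_real (?d t) / (of_real t - z))
     = (LINT t : I_cut k | lborel. of_real (d_density k t) / (of_real t - z))"
    unfolding set_lebesgue_integral_def
    by (intro Bochner_Integration.integral_cong) (auto simp: indicator_def I_cut_interval)
  finally show ?thesis by (simp add: g_ext_upper[OF k z])
qed

text \<open>Real z off I_k are limits of z + i/(n+1): the extension is continuous there, and the
  integrals converge by domination.\<close>

lemma g_ext_representation_real:
  assumes k: "even k" and z: "z \<notin> complex_of_real ` I_cut k" and "Im z = 0"
  shows "g_ext k z = (LINT t : I_cut k | lborel. of_real (d_density k t) / (of_real t - z)) - of_nat k"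
proof -
  let ?y = "\<lambda>n. 1 / real (Suc n)" and ?K = "\<lambda>z t. indicator (I_cut k) t *\<^sub>R (complex_of_real (d_density k t) / (of_real t - z))"
  let ?z = "\<lambda>n. z + \<i> * of_real (?y n)"
  have "?z \<longlonglongrightarrow> z + \<i> * of_real 0"
    by (intro tendsto_intros LIMSEQ_Suc lim_1_over_n)
  then have zlim: "?z \<longlonglongrightarrow> z" by (simp only: of_real_0 mult_zero_right add_0_right)
  obtain \<delta> where \<delta>: "\<delta> > 0" "\<And>t. t \<in> I_cut k \<Longrightarrow> \<delta> \<le> norm (of_real t - z)"
    using I_cut_dist_pos[OF z] by blast
  have up: "Im (?z n) > 0" for n using \<open>Im z = 0\<close> by simp
  have notin: "?z n \<notin> complex_of_real ` I_cut k" for n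
    using up[of n] by (metis Im_complex_of_real imageE less_irrefl)
  have "(\<lambda>n. integral\<^sup>L lborel (?K (?z n))) \<longlonglongrightarrow> integral\<^sup>L lborel (?K z)"
  proof (rule integral_dominated_convergence)
    show "?K z \<in> borel_measurable lborel"
      using d_density_kernel_integrable[OF k z] unfolding set_integrable_def by (rule borel_measurable_integrable)
    show "?K (?z n) \<in> borel_measurable lborel" for n
      using d_density_kernel_integrable[OF k notin] unfolding set_integrable_def by (rule borel_measurable_integrable)
    show "integrable lborel (\<lambda>t. \<bar>indicator (I_cut k) t *\<^sub>R d_density k t\<bar> / \<delta>)"
      using d_density_integrable[OF k] unfolding set_integrable_def by simp
    show "AE t in lborel. (\<lambda>n. ?K (?z n) t) \<longlonglongrightarrow> ?K z t"
    proof (rule AE_I2)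
      fix t
      show "(\<lambda>n. ?K (?z n) t) \<longlonglongrightarrow> ?K z t"
      proof (cases "t \<in> I_cut k")
        case True
        then have "of_real t - z \<noteq> 0" using \<delta>(1) \<delta>(2)[of t] by auto
        then show ?thesis by (intro tendsto_intros zlim)
      qed simp
    qed
    show "AE t in lborel. norm (?K (?z n) t) \<le> \<bar>indicator (I_cut k) t *\<^sub>R d_density k t\<bar> / \<delta>" for n
    proof (rule AE_I2)
      fix t
      show "norm (?K (?z n) t) \<le> \<bar>indicator (I_cut k) t *\<^sub>R d_density k t\<bar> / \<delta>"
      proof (cases "t \<in> I_cut k")
        case True
        \<comment> \<open>For real z and t, a vertical displacement of z only increases the distance
          to t.\<close>
        have "\<delta> \<le> \<bar>Re (of_real t - z)\<bar>"
          using \<delta>(2)[OF True] \<open>Im z = 0\<close> by (simp add: cmod_def)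
        also have "\<dots> = \<bar>Re (of_real t - ?z n)\<bar>" by simp
        also have "\<dots> \<le> norm (of_real t - ?z n)" by (rule abs_Re_le_cmod)
        finally have "\<bar>d_density k t\<bar> / norm (of_real t - ?z n) \<le> \<bar>d_density k t\<bar> / \<delta>"
          using \<delta>(1) by (intro divide_left_mono mult_pos_pos) auto
        then show ?thesis using True by (simp add: norm_divide)
      qed simp
    qed
  qed
  then have "(\<lambda>n. (LINT t : I_cut k | lborel. of_real (d_density k t) / (of_real t - ?z n)) - of_nat k)
     \<longlonglongrightarrow> (LINT t : I_cut k | lborel. of_real (d_density k t) / (of_real t - z)) - of_nat k"
    unfolding set_lebesgue_integral_def by (intro tendsto_intros)
  moreover have "(\<lambda>n. g_ext k (?z n)) \<longlonglongrightarrow> g_ext k z"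
    by (rule isCont_tendsto_compose[OF isCont_g_ext[OF k z] zlim])
  ultimately show ?thesis
    using g_ext_representation_upper[OF k up] LIMSEQ_unique by (metis (no_types, lifting) LIMSEQ_unique ext)
qed

text \<open>The lower half plane follows by conjugation, as the density is real and the extension
  symmetric.\<close>

lemma g_ext_representation:
  assumes k: "even k" and z: "z \<notin> complex_of_real ` I_cut k"
  shows "g_ext k z = (LINT t : I_cut k | lborel. of_real (d_density k t) / (of_real t - z)) - of_nat k"
proof -
  consider "Im z > 0" | "Im z = 0" | "Im (cnj z) > 0" by fastforce
  then show ?thesis
  proof cases
    case 1
    then show ?thesis by (rule g_ext_representation_upper[OF k])
  next
    case 2
    then show ?thesis by (rule g_ext_representation_real[OF k z])
  next
    case 3
    have "g_ext k z = cnj (g_ext k (cnj z))"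
      using g_ext_is_extension[OF k] z by (simp add: is_g_extension_def)
    also have "\<dots> = cnj (LINT t : I_cut k | lborel. of_real (d_density k t) / (of_real t - cnj z)) - of_nat k"
      using g_ext_representation_upper[OF k 3] by simp
    also have "cnj (LINT t : I_cut k | lborel. of_real (d_density k t) / (of_real t - cnj z))
      = (LINT t : I_cut k | lborel. of_real (d_density k t) / (of_real t - z))"
      unfolding set_lebesgue_integral_def Bochner_Integration.integral_cnj[symmetric] by simp
    finally show ?thesis .
  qed
qed

text \<open>Integrability is part of the claim because the integral of a non-integrable function
  defaults to 0, so the equation alone would not assert that the integral exists.\<close>

theorem theorem4p6:
  fixes k :: nat and z :: complex
  assumes "even k" and "z \<notin> complex_of_real ` I_cut k"
  shows "set_integrable lborel {- Gamma (Gamma_crit k) .. - Gamma (Gamma_crit (Suc k))}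
           (\<lambda>t. complex_of_real (d_density k t) / (complex_of_real t - z)) \<and>
         g_ext k z =
           (LINT t : {- Gamma (Gamma_crit k) .. - Gamma (Gamma_crit (Suc k))} | lborel.
              complex_of_real (d_density k t) / (complex_of_real t - z)) - of_nat k"
  using d_density_kernel_integrable[OF assms] g_ext_representation[OF assms]
  unfolding I_cut_interval[of k] by blast

end
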